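(* Let $l\geq 0$ and let $w$ be an even integer such that $\widetilde{M}^{\leq l}_w\neq\{0\}$. Then $$\nu_{\max}(l,w)\leq \delta_l(w)-1+\kappa_l,$$ where $\kappa_l$ is the common value of $d((l+1)w')-\delta_l(w')$ for all even $w'\geq 2l+12$ (this quantity is constant in that range).
   Context: Let $q=e^{2\pi i z}$, and let $E_2,E_4,E_6$ be the normalised Eisenstein series $E_2=1-24\sum_{n\ge1}\sigma_1(n)q^n$, $E_4=1+240\sum_{n\ge1}\sigma_3(n)q^n$, $E_6=1-504\sum_{n\ge1}\sigma_5(n)q^n$, with $\sigma_k(n)=\sum_{d\mid n}d^k$; they are algebraically independent and $\mathbb{C}[E_2,E_4,E_6]$ is graded by weights $2,4,6$. A quasi-modular form of weight $w$ is an element homogeneous of weight $w$; a non-zero such $f$ is uniquely $f=\sum_{i=0}^l f_iE_2^i$ with $f_i$ modular of weight $w-2i$ and $f_l\neq 0$, and $l$ is its depth. $\widetilde{M}^{\leq l}_w$ is the space of quasi-modular forms of weight $w$ and depth $\leq l$. Forms are identified with their $q$-expansions and $\nu(f)$ is the order of vanishing at $q=0$. $d(w)$ is the dimension of modular forms of weight $w$ for $\mathrm{SL}_2(\mathbb{Z})$ ($d(w)=0$ for $w<0$, $\lfloor w/12\rfloor$ if $w\ge 0$, $w\equiv2\pmod{12}$, and $\lfloor w/12\rfloor+1$ otherwise), $\delta_l(w)=\sum_{i=0}^l d(w-2i)$, and $\nu_{\max}(l,w)=\max\{\nu(f):f\in\widetilde{M}^{\leq l}_w\setminus\{0\}\}$.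 *)

theory Defs
  imports Complex_Main "HOL-Computational_Algebra.Formal_Power_Series"
begin

global_interpretation cfps: vector_space "\<lambda>(c::complex) (f::complex fps). fps_const c * f"
  by unfold_locales (simp_all add: algebra_simps flip: fps_const_add fps_const_mult)

definition divisor_sigma :: "nat \<Rightarrow> nat \<Rightarrow> nat"
  where "divisor_sigma k n = (\<Sum>d | d dvd n. d ^ k)"

definition E2 :: "complex fps"
  where "E2 = Abs_fps (\<lambda>n. if n = 0 then 1 else - 24 * of_nat (divisor_sigma 1 n))"

definition E4 :: "complex fps"
  where "E4 = Abs_fps (\<lambda>n. if n = 0 then 1 else 240 * of_nat (divisor_sigma 3 n))"

definition E6 :: "complex fps"
  where "E6 = Abs_fps (\<lambda>n. if n = 0 then 1 else - 504 * of_nat (divisor_sigma 5 n))"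

text \<open>
  All forms are identified with their \<open>q\<close>-expansions. Quasi-modular forms are the
  elements of the ring \<open>\<complex>[E2, E4, E6]\<close>, graded by the weights 2, 4, 6, and the
  modular forms for the full modular group are the subring \<open>\<complex>[E4, E6]\<close>. The
  definitions below are the homogeneous components of weight \<open>w\<close>; they are zero for
  negative or odd \<open>w\<close>.
\<close>

definition modular_forms :: "int \<Rightarrow> complex fps set"
  where "modular_forms w =
    cfps.span {E4 ^ b * E6 ^ c | b c. 4 * int b + 6 * int c = w}"

definition quasimodular_forms :: "int \<Rightarrow> complex fps set"
  where "quasimodular_forms w =
    cfps.span {E2 ^ a * E4 ^ b * E6 ^ c | a b c. 2 * int a + 4 * int b + 6 * int c = w}"

definition has_depth :: "int \<Rightarrow> complex fps \<Rightarrow> nat \<Rightarrow> bool"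
  where "has_depth w f l \<longleftrightarrow>
    (\<exists>g. (\<forall>i\<le>l. g i \<in> modular_forms (w - 2 * int i)) \<and> g l \<noteq> 0 \<and>
         f = (\<Sum>i\<le>l. g i * E2 ^ i))"

definition quasimodular_forms_depth_le :: "nat \<Rightarrow> int \<Rightarrow> complex fps set"
  where "quasimodular_forms_depth_le l w =
    {f \<in> quasimodular_forms w. f = 0 \<or> (\<exists>l'\<le>l. has_depth w f l')}"

definition dim_modular :: "int \<Rightarrow> nat"
  where "dim_modular w = cfps.dim (modular_forms w)"

definition delta :: "nat \<Rightarrow> int \<Rightarrow> nat"
  where "delta l w = (\<Sum>i\<le>l. dim_modular (w - 2 * int i))"

text \<open>
  On non-zero series, \<^const>\<open>subdegree\<close> is the order of vanishing at \<open>q = 0\<close>.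
\<close>

definition nu_max :: "nat \<Rightarrow> int \<Rightarrow> nat"
  where "nu_max l w = Max (subdegree ` (quasimodular_forms_depth_le l w - {0}))"

text \<open>
  The common value over all large even weights; that the difference is in fact constant
  there has to be proved separately.
\<close>

definition kappa :: "nat \<Rightarrow> int"
  where "kappa l = (THE k. \<forall>w. even w \<and> w \<ge> 2 * int l + 12 \<longrightarrow>
    int (dim_modular ((int l + 1) * w)) - int (delta l w) = k)"

end

theory Submission
  imports Defs "Jordan_Normal_Form.Determinant"
begin

text \<open>
  Let \<open>f = \<Sum>i\<le>l. g i * E2 ^ i\<close> and let \<open>X\<close>, \<open>Z\<close> be variables of weight \<open>-1\<close> and \<open>1\<close>. The vector
  \<open>\<Sum>i\<le>l. g i * X ^ (l - i) * Z ^ i\<close> has modular coordinates, and by Ramanujan's differential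
  equations so do its iterated derivatives under a connection which in the basis \<open>X\<close>,
  \<open>Y = Z - E2 * X\<close> is \<open>q d/dq\<close> plus the nilpotent map \<open>X \<mapsto> Y / 12\<close>, \<open>Y \<mapsto> 0\<close>, up to scalars.
  The determinant of the first \<open>l + 1\<close> of these vectors is a modular form of weight \<open>(l + 1) w\<close>.
  It is divisible by \<open>q ^ \<nu>(f)\<close>, because the coefficients of \<open>X ^ l\<close> (obtained by \<open>Z = E2\<close>, \<open>X = 1\<close>)
  are combinations of \<open>f\<close> and its derivatives, and it does not vanish: a proper invariant
  subspace containing the vector would produce a solution \<open>y\<close> of \<open>q dy/dq = c\<close>, \<open>c \<noteq> 0\<close>, which is
  impossible without a logarithm. Hence \<open>\<nu>(f)\<close> is less
  than the dimension of the modular forms of weight \<open>(l + 1) w\<close>, which is compared with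
  \<open>delta l w + kappa l\<close> by the quasi-periodicity of the dimension formula.
\<close>

section \<open>Sums over the solutions of \<open>a x + b y = n\<close>\<close>

definition convolution_quadruples :: "nat \<Rightarrow> (nat \<times> nat \<times> nat \<times> nat) set"
  where "convolution_quadruples n =
    {(a, b, x, y). 0 < a \<and> 0 < b \<and> 0 < x \<and> 0 < y \<and> a * x + b * y = n}"

lemma mem_convolution_quadruples [simp]:
  "(a, b, x, y) \<in> convolution_quadruples n \<longleftrightarrow>
    0 < a \<and> 0 < b \<and> 0 < x \<and> 0 < y \<and> a * x + b * y = n"
  by (simp add: convolution_quadruples_def)

lemma dvd_div_pos: "0 < d" "0 < n div d" if "d dvd n" "0 < n" for d n :: nat
  using that by (auto simp: dvd_div_eq_0_iff dvd_pos_nat simp flip: neq0_conv)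

lemma finite_convolution_quadruples: "finite (convolution_quadruples n)"
proof (rule finite_subset)
  have "a \<le> n \<and> b \<le> n \<and> x \<le> n \<and> y \<le> n"
    if "0 < a" "0 < b" "0 < x" "0 < y" "a * x + b * y = n" for a b x y :: nat
  proof -
    have "a \<le> a * x" "x \<le> a * x" "b \<le> b * y" "y \<le> b * y"
      using that by simp_all
    then show ?thesis
      using that(5) by linarith
  qed
  then show "convolution_quadruples n \<subseteq> {..n} \<times> {..n} \<times> {..n} \<times> {..n}"
    by (auto simp: convolution_quadruples_def)
qed simp

text \<open>The index is \<open>i = a * x\<close>; once \<open>i\<close> is fixed, \<open>x\<close>
  and \<open>y\<close> are the cofactors of a divisor \<open>a\<close> of \<open>i\<close> and a
  divisor \<open>b\<close> of \<open>n - i\<close>.\<close>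

lemma sum_convolution_quadruples:
  fixes g h :: "nat \<Rightarrow> 'a::comm_semiring_1"
  shows "(\<Sum>(a, b, x, y)\<in>convolution_quadruples n. g a * h b) =
    (\<Sum>i=1..<n. (\<Sum>d | d dvd i. g d) * (\<Sum>d | d dvd n - i. h d))"
proof -
  let ?A = "SIGMA i:{1..<n}. {d. d dvd i} \<times> {d. d dvd n - i}"
  have "(\<Sum>i=1..<n. (\<Sum>d | d dvd i. g d) * (\<Sum>d | d dvd n - i. h d)) =
      (\<Sum>i=1..<n. \<Sum>(a, b)\<in>{d. d dvd i} \<times> {d. d dvd n - i}. g a * h b)"
    by (simp add: sum_product sum.cartesian_product)
  also have "\<dots> = (\<Sum>(i, a, b)\<in>?A. g a * h b)"
    by (subst sum.Sigma) auto
  also have "\<dots> = (\<Sum>(a, b, x, y)\<in>convolution_quadruples n. g a * h b)"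
  proof (rule sum.reindex_bij_witness
      [where j = "\<lambda>(i, a, b). (a, b, i div a, (n - i) div b)"
        and i = "\<lambda>(a, b, x, y). (a * x, a, b)"], goal_cases)
    case (2 t)
    then show ?case
      by (cases t) (auto simp: Suc_le_eq dvd_div_pos intro: dvd_div_pos(1))
  qed auto
  finally show ?thesis ..
qed

text \<open>
  The map \<open>(a, b, x, y) \<mapsto> (x + y, x, b, a - b)\<close> permutes the solutions of
  \<open>a x + b y = n\<close> with \<open>a > b\<close>, and exchanging the pairs \<open>(a, x)\<close> and \<open>(b, y)\<close>
  maps \<open>a > b\<close> to \<open>a < b\<close>. For suitable \<open>F\<close> only the solutions with \<open>a = b\<close> survive.
\<close>

lemma sum_convolution_quadruples_invariant:
  fixes F :: "nat \<Rightarrow> nat \<Rightarrow> 'a::ab_group_add"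
  assumes F: "\<And>a b. F a b = F b a" and F': "\<And>a b. F (a + b) a = F (a + b) b"
    and n: "n > 0"
  shows "(\<Sum>(a, b, x, y)\<in>convolution_quadruples n. F a b - F (a + b) a) =
    (\<Sum>d | d dvd n. \<Sum>x=1..<d. F (n div d) (n div d) - F d x)"
proof -
  let ?R = "convolution_quadruples n"
  let ?G = "{(a, b, x, y)\<in>?R. a > b}" and ?L = "{(a, b, x, y)\<in>?R. a < b}"
  let ?E = "{(a, b, x, y)\<in>?R. a = b}"
  let ?Q = "\<lambda>(a, b, x, y). F a b - F (x + y) x"
  note [simp] = finite_convolution_quadruples
  \<comment> \<open>The permutation is its own inverse and carries \<open>F (x + y) x\<close> to
    \<open>F a b\<close>, so the part with \<open>a > b\<close> cancels.\<close>
  have T: "(\<Sum>(a, b, x, y)\<in>?G. F (x + y) x) = (\<Sum>(a, b, x, y)\<in>?G. F a b)"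
    by (rule sum.reindex_bij_witness
        [where j = "\<lambda>(a, b, x, y). (x + y, x, b, a - b)"
          and i = "\<lambda>(a, b, x, y). (x + y, x, b, a - b)"])
      (clarsimp simp: algebra_simps dest!: less_imp_Suc_add; fail)+
  have G: "sum ?Q ?G = 0"
    using T by (simp add: case_prod_unfold sum_subtractf)
  have swap: "F b a - F (y + x) y = F a b - F (x + y) x" for a b x y
    using F[of a b] F'[of x y] by (simp add: add.commute)
  have L: "sum ?Q ?L = sum ?Q ?G"
    by (rule sum.reindex_bij_witness
        [where j = "\<lambda>(a, b, x, y). (b, a, y, x)" and i = "\<lambda>(a, b, x, y). (b, a, y, x)"])
      (auto simp: swap)
  \<comment> \<open>If \<open>a = b\<close> then \<open>a * (x + y) = n\<close>, so
    \<open>d = x + y\<close> runs through the divisors of \<open>n\<close> and \<open>x\<close>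
    through the splittings of \<open>d\<close> into two positive parts.\<close>
  have E: "sum ?Q ?E = (\<Sum>(d, x)\<in>(SIGMA d:{d. d dvd n}. {1..<d}). F (n div d) (n div d) - F d x)"
    by (intro sum.reindex_bij_witness
        [where j = "\<lambda>(a, b, x, y). (x + y, x)" and i = "\<lambda>(d, x). (n div d, n div d, x, d - x)"])
      (clarsimp simp: n dvd_div_pos simp flip: distrib_left; fail)+
  \<comment> \<open>Exchanging \<open>(a, b)\<close> with \<open>(x, y)\<close> keeps the equation
    and puts the subtracted term in the form used in \<open>?Q\<close>.\<close>
  have "(\<Sum>(a, b, x, y)\<in>?R. F (a + b) a) = (\<Sum>(a, b, x, y)\<in>?R. F (x + y) x)"
    by (rule sum.reindex_bij_witness
        [where j = "\<lambda>(a, b, x, y). (x, y, a, b)" and i = "\<lambda>(a, b, x, y). (x, y, a, b)"])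
      (auto simp: mult.commute)
  then have "(\<Sum>(a, b, x, y)\<in>?R. F a b - F (a + b) a) = sum ?Q ?R"
    by (simp add: case_prod_unfold sum_subtractf)
  also have "\<dots> = sum ?Q (?G \<union> ?L \<union> ?E)"
    by (rule arg_cong[where f = "sum ?Q"]) auto
  also have "\<dots> = sum ?Q ?G + sum ?Q ?L + sum ?Q ?E"
  proof -
    have "finite ?G" "finite ?L" "finite ?E"
      by (auto intro: finite_subset[OF _ finite_convolution_quadruples[of n]])
    then show ?thesis
      by (subst sum.union_disjoint, auto)+
  qed
  also have "\<dots> = (\<Sum>d | d dvd n. \<Sum>x=1..<d. F (n div d) (n div d) - F d x)"
    unfolding G L E using n by (subst sum.Sigma) auto
  finally show ?thesis .
qed

section \<open>Convolutions of divisor functions and Ramanujan's differential equations\<close>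

definition divisor_series :: "nat \<Rightarrow> complex fps"
  where "divisor_series k = Abs_fps (\<lambda>n. if n = 0 then 0 else of_nat (divisor_sigma k n))"

text \<open>This is \<open>q d/dq\<close>. It multiplies the coefficient of \<open>q ^ n\<close> by
  \<open>n\<close>, so a power of \<open>q\<close> dividing a series also divides its image.\<close>

definition fps_theta :: "'a::comm_semiring_1 fps \<Rightarrow> 'a fps"
  where "fps_theta f = fps_X * fps_deriv f"

lemma fps_nth_fps_theta [simp]: "fps_nth (fps_theta f) n = of_nat n * fps_nth f n"
  by (cases n) (simp_all add: fps_theta_def)

lemma fps_theta_add [simp]: "fps_theta (f + g) = fps_theta f + fps_theta g"
  by (simp add: fps_theta_def algebra_simps)

lemma fps_theta_mult [simp]:
  fixes f g :: "'a::comm_ring_1 fps"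
  shows "fps_theta (f * g) = f * fps_theta g + fps_theta f * g"
  by (simp add: fps_theta_def algebra_simps)

lemma fps_theta_const [simp]: "fps_theta (fps_const c) = 0"
  by (simp add: fps_theta_def)

lemma fps_theta_0 [simp]: "fps_theta 0 = 0"
  by (simp add: fps_theta_def)

lemma fps_theta_1 [simp]: "fps_theta 1 = 0"
  by (simp add: fps_theta_def)

lemma fps_theta_diff [simp]:
  "fps_theta (f - g) = fps_theta f - fps_theta (g :: 'a::comm_ring_1 fps)"
  by (simp add: fps_theta_def algebra_simps)

lemma fps_theta_numeral [simp]: "fps_theta (numeral k) = 0"
  by (simp add: fps_theta_def)

lemma fps_theta_sum:
  "fps_theta (\<Sum>i\<in>A. f i) = (\<Sum>i\<in>A. fps_theta (f i :: 'a::comm_ring_1 fps))"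
  by (induction A rule: infinite_finite_induct) simp_all

lemma fps_theta_power:
  "fps_theta (f ^ n) = of_nat n * f ^ (n - 1) * fps_theta (f :: 'a::comm_ring_1 fps)"
  by (simp add: fps_theta_def fps_deriv_power' ac_simps)

lemma divisor_series_mult_nth:
  assumes "n > 0"
  shows "fps_nth (divisor_series j * divisor_series k) n =
    (\<Sum>(a, b, x, y)\<in>convolution_quadruples n. of_nat a ^ j * of_nat b ^ k)"
proof -
  have "fps_nth (divisor_series j * divisor_series k) n =
      (\<Sum>i=0..n. fps_nth (divisor_series j) i * fps_nth (divisor_series k) (n - i))"
    by (simp add: fps_mult_nth)
  also have "\<dots> = (\<Sum>i=1..<n. fps_nth (divisor_series j) i * fps_nth (divisor_series k) (n - i))"
    by (rule sum.mono_neutral_right) (auto simp: divisor_series_def)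
  also have "\<dots> = (\<Sum>i=1..<n. of_nat (divisor_sigma j i) * of_nat (divisor_sigma k (n - i)))"
    by (rule sum.cong) (auto simp: divisor_series_def)
  finally show ?thesis
    by (subst sum_convolution_quadruples) (simp add: divisor_sigma_def)
qed

text \<open>Symmetrised because \<open>F a b - F (a + b) a\<close>, for admissible \<open>F\<close>,
  is symmetric in \<open>a\<close> and \<open>b\<close>.\<close>

lemma divisor_series_mult_sym_nth:
  assumes "n > 0"
  shows "(\<Sum>(a, b, x, y)\<in>convolution_quadruples n.
      of_nat a ^ j * of_nat b ^ k + of_nat a ^ k * of_nat b ^ j) =
    2 * fps_nth (divisor_series j * divisor_series k) n"
proof -
  have "(\<Sum>(a, b, x, y)\<in>convolution_quadruples n. of_nat a ^ k * of_nat b ^ j) =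
      fps_nth (divisor_series j * divisor_series k) n"
    by (subst mult.commute) (simp add: divisor_series_mult_nth assms)
  then show ?thesis
    by (simp add: divisor_series_mult_nth[OF assms] case_prod_unfold sum.distrib)
qed

section \<open>Convolution identities from invariant polynomials\<close>

lemma sum_cofactor_powers:
  assumes "n > 0"
  shows "(\<Sum>d | d dvd n. of_nat (n div d) ^ k) = (of_nat (divisor_sigma k n) :: complex)"
  unfolding divisor_sigma_def of_nat_sum of_nat_power
  using assms by (intro sum.reindex_bij_witness[where i = "\<lambda>d. n div d" and j = "\<lambda>d. n div d"])
    (auto simp: dvd_div_pos)

lemma sum_cofactor_powers':
  assumes "n > 0"
  shows "(\<Sum>d | d dvd n. of_nat d * of_nat (n div d) ^ Suc k) =
    (of_nat (n * divisor_sigma k n) :: complex)"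
proof -
  have "(\<Sum>d | d dvd n. of_nat d * of_nat (n div d) ^ Suc k :: complex) =
      (\<Sum>d | d dvd n. of_nat n * of_nat (n div d) ^ k)"
    by (rule sum.cong) (auto simp: mult.assoc[symmetric] simp flip: of_nat_mult)
  then show ?thesis
    by (simp add: sum_cofactor_powers[OF assms] flip: sum_distrib_left)
qed

text \<open>A norm form of the Eisenstein integers. It is invariant under exchanging its arguments
  and under the reflection \<open>b \<mapsto> a - b\<close>, so all its powers are admissible in
  \<open>sum_convolution_quadruples_invariant\<close>.\<close>

definition hexagonal :: "nat \<Rightarrow> nat \<Rightarrow> complex"
  where "hexagonal a b = of_nat a ^ 2 - of_nat a * of_nat b + of_nat b ^ 2"

lemma hexagonal_commute: "hexagonal a b = hexagonal b a"
  and hexagonal_add: "hexagonal (a + b) a = hexagonal (a + b) b"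
  by (simp_all add: hexagonal_def power2_eq_square algebra_simps)

text \<open>The \<open>d - 1\<close> copies of \<open>(n div d) ^ (2 * k)\<close> add up to
  \<open>n * divisor_sigma (2 * k - 1) n\<close> minus \<open>divisor_sigma (2 * k) n\<close>.
  Letting the inner sum start at \<open>x = 0\<close> costs the same
  \<open>divisor_sigma (2 * k) n\<close>, and the two cancel.\<close>

lemma sum_hexagonal_power:
  assumes "n > 0" "k > 0"
  shows "(\<Sum>(a, b, x, y)\<in>convolution_quadruples n. hexagonal a b ^ k - hexagonal (a + b) a ^ k) =
    of_nat (n * divisor_sigma (2 * k - 1) n) - (\<Sum>d | d dvd n. \<Sum>x<d. hexagonal d x ^ k)"
proof -
  have "(\<Sum>(a, b, x, y)\<in>convolution_quadruples n. hexagonal a b ^ k - hexagonal (a + b) a ^ k) =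
      (\<Sum>d | d dvd n. \<Sum>x=1..<d. hexagonal (n div d) (n div d) ^ k - hexagonal d x ^ k)"
    by (rule sum_convolution_quadruples_invariant)
      (use assms hexagonal_commute hexagonal_add in metis)+
  also have "\<dots> = (\<Sum>d | d dvd n. of_nat d * of_nat (n div d) ^ Suc (2 * k - 1) -
      of_nat (n div d) ^ (2 * k) + of_nat d ^ (2 * k) - (\<Sum>x<d. hexagonal d x ^ k))"
  proof (rule sum.cong[OF refl], goal_cases)
    case (1 d)
    then obtain e where d: "d = Suc e"
      using assms by (metis dvd_div_pos(1) gr0_implies_Suc mem_Collect_eq)
    have diag: "hexagonal m m ^ k = of_nat m ^ (2 * k)" "hexagonal m 0 ^ k = of_nat m ^ (2 * k)" for m
      by (simp_all add: hexagonal_def power2_eq_square power_mult)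
    have "(\<Sum>x<d. hexagonal d x ^ k) = hexagonal d 0 ^ k + (\<Sum>x=1..<d. hexagonal d x ^ k)"
      using d by (simp add: lessThan_atLeast0 sum.atLeast_Suc_lessThan)
    then show ?case
      using assms by (simp add: d sum_subtractf diag algebra_simps)
  qed
  also have "\<dots> = of_nat (n * divisor_sigma (2 * k - 1) n) - (\<Sum>d | d dvd n. \<Sum>x<d. hexagonal d x ^ k)"
    unfolding sum_subtractf sum.distrib sum_cofactor_powers'[OF assms(1)]
      sum_cofactor_powers[OF assms(1)]
    by (simp add: divisor_sigma_def)
  finally show ?thesis .
qed

lemma divisor_series_eqI:
  fixes f g :: "complex fps"
  assumes "fps_nth f 0 = 0" "fps_nth g 0 = 0" "\<And>n. n > 0 \<Longrightarrow> fps_nth f n = fps_nth g n"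
  shows "f = g"
  using assms by (metis fps_ext gr0I)

lemma fps_nth_divisor_series:
  "n > 0 \<Longrightarrow> fps_nth (divisor_series k) n = (\<Sum>d | d dvd n. of_nat d ^ k)"
  by (simp add: divisor_series_def divisor_sigma_def)

lemma divisor_series_nth_0 [simp]: "fps_nth (divisor_series k) 0 = 0"
  by (simp add: divisor_series_def)

text \<open>The length \<open>m\<close> is separated from \<open>d\<close> so that induction on
  \<open>m\<close> applies; later \<open>m\<close> is the number \<open>d\<close> itself. The
  factors 6, 30 and 420 clear the denominators of the power sums.\<close>

lemma sum_hexagonal:
  fixes d :: complex
  shows sum_hexagonal_1: "6 * (\<Sum>x<m. d ^ 2 - d * of_nat x + of_nat x ^ 2) =
      6 * of_nat m * d ^ 2 - 3 * d * (of_nat m ^ 2 - of_nat m) +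
      (2 * of_nat m ^ 3 - 3 * of_nat m ^ 2 + of_nat m)"
    and sum_hexagonal_2: "30 * (\<Sum>x<m. (d ^ 2 - d * of_nat x + of_nat x ^ 2) ^ 2) =
      30 * of_nat m * d ^ 4 - 30 * d ^ 3 * (of_nat m ^ 2 - of_nat m) +
      15 * d ^ 2 * (2 * of_nat m ^ 3 - 3 * of_nat m ^ 2 + of_nat m) -
      15 * d * (of_nat m ^ 4 - 2 * of_nat m ^ 3 + of_nat m ^ 2) +
      (6 * of_nat m ^ 5 - 15 * of_nat m ^ 4 + 10 * of_nat m ^ 3 - of_nat m)"
    and sum_hexagonal_3: "420 * (\<Sum>x<m. (d ^ 2 - d * of_nat x + of_nat x ^ 2) ^ 3) =
      420 * of_nat m * d ^ 6 - 630 * d ^ 5 * (of_nat m ^ 2 - of_nat m) +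
      420 * d ^ 4 * (2 * of_nat m ^ 3 - 3 * of_nat m ^ 2 + of_nat m) -
      735 * d ^ 3 * (of_nat m ^ 4 - 2 * of_nat m ^ 3 + of_nat m ^ 2) +
      84 * d ^ 2 * (6 * of_nat m ^ 5 - 15 * of_nat m ^ 4 + 10 * of_nat m ^ 3 - of_nat m) -
      105 * d * (2 * of_nat m ^ 6 - 6 * of_nat m ^ 5 + 5 * of_nat m ^ 4 - of_nat m ^ 2) +
      10 * (6 * of_nat m ^ 7 - 21 * of_nat m ^ 6 + 21 * of_nat m ^ 5 - 7 * of_nat m ^ 3 + of_nat m)"
    and sum_square_products: "30 * (\<Sum>x<m. (of_nat x * (d - of_nat x)) ^ 2) =
      5 * d ^ 2 * (2 * of_nat m ^ 3 - 3 * of_nat m ^ 2 + of_nat m) -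
      15 * d * (of_nat m ^ 4 - 2 * of_nat m ^ 3 + of_nat m ^ 2) +
      (6 * of_nat m ^ 5 - 15 * of_nat m ^ 4 + 10 * of_nat m ^ 3 - of_nat m)"
  by (induction m; simp add: algebra_simps power_numeral_reduce)+

text \<open>Exponent 1 of the hexagonal form: the difference under the sum is
  \<open>- 2 * a * b\<close>.\<close>

lemma divisor_series_1_1:
  "12 * (divisor_series 1 * divisor_series 1) =
    5 * divisor_series 3 + divisor_series 1 - 6 * fps_theta (divisor_series 1)"
proof (rule divisor_series_eqI)
  fix n :: nat assume n: "n > 0"
  note nth = fps_nth_divisor_series[OF n] numeral_fps_const fps_mult_left_const_nth
  have inner: "6 * (\<Sum>x<d. hexagonal d x ^ 1) = 5 * of_nat d ^ 3 + of_nat d" for d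
    using sum_hexagonal_1[of "of_nat d" d]
    by (simp add: hexagonal_def power_numeral_reduce algebra_simps)
  have conv: "2 * fps_nth (divisor_series 1 * divisor_series 1) n =
      - (\<Sum>(a, b, x, y)\<in>convolution_quadruples n. hexagonal a b ^ 1 - hexagonal (a + b) a ^ 1)"
    unfolding divisor_series_mult_sym_nth[OF n, symmetric] sum_negf[symmetric]
    by (rule sum.cong) (auto simp: hexagonal_def power2_eq_square algebra_simps)
  have W: "6 * (\<Sum>d | d dvd n. \<Sum>x<d. hexagonal d x ^ 1) =
      5 * fps_nth (divisor_series 3) n + fps_nth (divisor_series 1) n"
    unfolding sum_distrib_left[of _ _ "{d. d dvd n}"] inner by (simp add: nth sum.distrib sum_distrib_left)
  have "fps_nth (12 * (divisor_series 1 * divisor_series 1)) n =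
      6 * (2 * fps_nth (divisor_series 1 * divisor_series 1) n)"
    by (simp add: numeral_fps_const)
  also have "\<dots> = 6 * (\<Sum>d | d dvd n. \<Sum>x<d. hexagonal d x ^ 1) -
      6 * of_nat (n * divisor_sigma (2 * 1 - 1) n)"
    unfolding conv sum_hexagonal_power[OF n less_numeral_extra(1)] by (simp only: minus_diff_eq right_diff_distrib)
  also have "\<dots> =
      fps_nth (5 * divisor_series 3 + divisor_series 1 - 6 * fps_theta (divisor_series 1)) n"
    unfolding W using n by (simp add: numeral_fps_const divisor_series_def)
  finally show "fps_nth (12 * (divisor_series 1 * divisor_series 1)) n = \<dots>" .
qed (simp_all add: numeral_fps_const)

text \<open>Exponent 2 of the hexagonal form: the difference is
  \<open>- 4 * (a * b ^ 3 + a ^ 3 * b)\<close>.\<close>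

lemma divisor_series_1_3:
  "240 * (divisor_series 1 * divisor_series 3) = 21 * divisor_series 5 +
    10 * divisor_series 3 - 30 * fps_theta (divisor_series 3) - divisor_series 1"
proof (rule divisor_series_eqI)
  fix n :: nat assume n: "n > 0"
  note nth = fps_nth_divisor_series[OF n] numeral_fps_const fps_mult_left_const_nth
  have inner: "30 * (\<Sum>x<d. hexagonal d x ^ 2) =
      21 * of_nat d ^ 5 + 10 * of_nat d ^ 3 - of_nat d" for d
    using sum_hexagonal_2[of "of_nat d" d]
    by (simp add: hexagonal_def power_numeral_reduce algebra_simps)
  have conv: "4 * (2 * fps_nth (divisor_series 1 * divisor_series 3) n) =
      - (\<Sum>(a, b, x, y)\<in>convolution_quadruples n. hexagonal a b ^ 2 - hexagonal (a + b) a ^ 2)"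
    unfolding divisor_series_mult_sym_nth[OF n, symmetric] sum_negf[symmetric] sum_distrib_left
    by (rule sum.cong) (auto simp: hexagonal_def power_numeral_reduce algebra_simps)
  have W: "30 * (\<Sum>d | d dvd n. \<Sum>x<d. hexagonal d x ^ 2) =
      21 * fps_nth (divisor_series 5) n + 10 * fps_nth (divisor_series 3) n -
      fps_nth (divisor_series 1) n"
    unfolding sum_distrib_left[of _ _ "{d. d dvd n}"] inner
    by (simp add: nth sum.distrib sum_subtractf sum_distrib_left)
  have "fps_nth (240 * (divisor_series 1 * divisor_series 3)) n =
      30 * (4 * (2 * fps_nth (divisor_series 1 * divisor_series 3) n))"
    by (simp add: numeral_fps_const)
  also have "\<dots> = 30 * (\<Sum>d | d dvd n. \<Sum>x<d. hexagonal d x ^ 2) -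
      30 * of_nat (n * divisor_sigma (2 * 2 - 1) n)"
    unfolding conv sum_hexagonal_power[OF n zero_less_numeral]
    by (simp only: minus_diff_eq right_diff_distrib)
  also have "\<dots> = fps_nth (21 * divisor_series 5 + 10 * divisor_series 3 -
        30 * fps_theta (divisor_series 3) - divisor_series 1) n"
    unfolding W using n by (simp add: numeral_fps_const divisor_series_def)
  finally show "fps_nth (240 * (divisor_series 1 * divisor_series 3)) n = \<dots>" .
qed (simp_all add: numeral_fps_const)

text \<open>This amounts to \<open>E4 ^ 2 = E8\<close>. The invariant polynomial \<open>F\<close>
  vanishes on the diagonal, and its difference is the single monomial
  \<open>- 4 * a ^ 3 * b ^ 3\<close>; hence no derivative appears.\<close>

lemma divisor_series_3_3:
  "120 * (divisor_series 3 * divisor_series 3) = divisor_series 7 - divisor_series 3"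
proof (rule divisor_series_eqI)
  fix n :: nat assume n: "n > 0"
  note nth = fps_nth_divisor_series[OF n] numeral_fps_const fps_mult_left_const_nth
  define F :: "nat \<Rightarrow> nat \<Rightarrow> complex"
    where "F a b = (of_nat a * of_nat b * (of_nat a - of_nat b)) ^ 2" for a b
  have F: "F a b = F b a" "F (a + b) a = F (a + b) b" for a b
    by (simp_all add: F_def power2_eq_square algebra_simps)
  have inner: "30 * (\<Sum>x=1..<d. F d x) = of_nat d ^ 7 - of_nat d ^ 3" for d
  proof -
    have "(\<Sum>x=1..<d. F d x) = (\<Sum>x<d. F d x)"
      by (rule sum.mono_neutral_left) (auto simp: F_def)
    also have "\<dots> = of_nat d ^ 2 * (\<Sum>x<d. (of_nat x * (of_nat d - of_nat x)) ^ 2)"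
      unfolding sum_distrib_left by (rule sum.cong) (auto simp: F_def power_mult_distrib)
    finally have "30 * (\<Sum>x=1..<d. F d x) =
        of_nat d ^ 2 * (30 * (\<Sum>x<d. (of_nat x * (of_nat d - of_nat x)) ^ 2))"
      by simp
    also have "\<dots> = of_nat d ^ 7 - of_nat d ^ 3"
      unfolding sum_square_products by (simp add: power_numeral_reduce algebra_simps)
    finally show ?thesis .
  qed
  have "2 * (2 * fps_nth (divisor_series 3 * divisor_series 3) n) =
      - (\<Sum>(a, b, x, y)\<in>convolution_quadruples n. F a b - F (a + b) a)"
    unfolding divisor_series_mult_sym_nth[OF n, symmetric] sum_negf[symmetric] sum_distrib_left
    by (rule sum.cong) (auto simp: F_def power_numeral_reduce algebra_simps)
  also have "\<dots> = (\<Sum>d | d dvd n. \<Sum>x=1..<d. F d x)"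
    by (subst sum_convolution_quadruples_invariant[OF F n]) (simp add: F_def sum_negf)
  finally have "30 * (4 * fps_nth (divisor_series 3 * divisor_series 3) n) =
      30 * (\<Sum>d | d dvd n. \<Sum>x=1..<d. F d x)"
    by simp
  also have "\<dots> = fps_nth (divisor_series 7) n - fps_nth (divisor_series 3) n"
    unfolding sum_distrib_left[of _ _ "{d. d dvd n}"] inner by (simp add: nth sum_subtractf)
  finally show "fps_nth (120 * (divisor_series 3 * divisor_series 3)) n =
      fps_nth (divisor_series 7 - divisor_series 3) n"
    by (simp add: numeral_fps_const)
qed (simp_all add: numeral_fps_const)

text \<open>Exponent 3 of the hexagonal form gives
  \<open>- 6 * (a * b ^ 5 + a ^ 5 * b) - 14 * a ^ 3 * b ^ 3\<close>; the last monomial is removed by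
  \<open>divisor_series_3_3\<close>.\<close>

lemma divisor_series_1_5:
  "504 * (divisor_series 1 * divisor_series 5) = 20 * divisor_series 7 +
    21 * divisor_series 5 - 42 * fps_theta (divisor_series 5) + divisor_series 1"
proof (rule divisor_series_eqI)
  fix n :: nat assume n: "n > 0"
  note nth = fps_nth_divisor_series[OF n] numeral_fps_const fps_mult_left_const_nth
  have inner: "420 * (\<Sum>x<d. hexagonal d x ^ 3) =
      249 * of_nat d ^ 7 + 210 * of_nat d ^ 5 - 49 * of_nat d ^ 3 + 10 * of_nat d" for d
    using sum_hexagonal_3[of "of_nat d" d]
    by (simp add: hexagonal_def power_numeral_reduce algebra_simps)
  have conv: "6 * (2 * fps_nth (divisor_series 1 * divisor_series 5) n) +
      7 * (2 * fps_nth (divisor_series 3 * divisor_series 3) n) =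
      - (\<Sum>(a, b, x, y)\<in>convolution_quadruples n. hexagonal a b ^ 3 - hexagonal (a + b) a ^ 3)"
    unfolding divisor_series_mult_sym_nth[OF n, symmetric] sum_negf[symmetric]
      sum_distrib_left sum.distrib[symmetric]
    by (rule sum.cong) (auto simp: hexagonal_def power_numeral_reduce algebra_simps)
  have W: "420 * (\<Sum>d | d dvd n. \<Sum>x<d. hexagonal d x ^ 3) =
      249 * fps_nth (divisor_series 7) n + 210 * fps_nth (divisor_series 5) n -
      49 * fps_nth (divisor_series 3) n + 10 * fps_nth (divisor_series 1) n"
    unfolding sum_distrib_left[of _ _ "{d. d dvd n}"] inner
    by (simp add: nth sum.distrib sum_subtractf sum_distrib_left)
  have cubes: "120 * fps_nth (divisor_series 3 * divisor_series 3) n =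
      fps_nth (divisor_series 7) n - fps_nth (divisor_series 3) n"
    using arg_cong[OF divisor_series_3_3, of "\<lambda>f. fps_nth f n"]
    by (simp add: numeral_fps_const)
  \<comment> \<open>The constants satisfy \<open>10 * 504 = 420 * 12\<close> and
    \<open>420 * 14 = 49 * 120\<close>, which eliminates the product of cubes.\<close>
  have "10 * fps_nth (504 * (divisor_series 1 * divisor_series 5)) n =
      420 * (6 * (2 * fps_nth (divisor_series 1 * divisor_series 5) n) +
        7 * (2 * fps_nth (divisor_series 3 * divisor_series 3) n)) -
      49 * (120 * fps_nth (divisor_series 3 * divisor_series 3) n)"
    by (simp add: numeral_fps_const)
  also have "\<dots> = 420 * (\<Sum>d | d dvd n. \<Sum>x<d. hexagonal d x ^ 3) -
      420 * of_nat (n * divisor_sigma (2 * 3 - 1) n) -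
      49 * (fps_nth (divisor_series 7) n - fps_nth (divisor_series 3) n)"
    unfolding conv cubes sum_hexagonal_power[OF n zero_less_numeral]
    by (simp only: minus_diff_eq right_diff_distrib)
  also have "\<dots> = 10 * fps_nth (20 * divisor_series 7 + 21 * divisor_series 5 -
        42 * fps_theta (divisor_series 5) + divisor_series 1) n"
    unfolding W using n by (simp add: numeral_fps_const divisor_series_def algebra_simps)
  finally show "fps_nth (504 * (divisor_series 1 * divisor_series 5)) n =
      fps_nth (20 * divisor_series 7 + 21 * divisor_series 5 -
        42 * fps_theta (divisor_series 5) + divisor_series 1) n"
    by (rule mult_left_cancel[THEN iffD1, rotated]) simp
qed (simp_all add: numeral_fps_const)

section \<open>Ramanujan's differential equations\<close>

lemma E2_altdef: "E2 = 1 - 24 * divisor_series 1"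
  and E4_altdef: "E4 = 1 + 240 * divisor_series 3"
  and E6_altdef: "E6 = 1 - 504 * divisor_series 5"
  by (simp_all add: fps_eq_iff E2_def E4_def E6_def divisor_series_def numeral_fps_const)

lemma fps_theta_E2: "12 * fps_theta E2 = E2 ^ 2 - E4"
proof -
  have "E2 ^ 2 - E4 = 48 * (12 * (divisor_series 1 * divisor_series 1)) -
      48 * divisor_series 1 - 240 * divisor_series 3"
    by (simp add: E2_altdef E4_altdef power2_eq_square algebra_simps)
  also have "\<dots> = 12 * fps_theta E2"
    unfolding divisor_series_1_1 by (simp add: E2_altdef algebra_simps)
  finally show ?thesis ..
qed

lemma fps_theta_E4: "3 * fps_theta E4 = E2 * E4 - E6"
proof -
  have "E2 * E4 - E6 = 504 * divisor_series 5 + 240 * divisor_series 3 - 24 * divisor_series 1 -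
      24 * (240 * (divisor_series 1 * divisor_series 3))"
    by (simp add: E2_altdef E4_altdef E6_altdef algebra_simps)
  also have "\<dots> = 3 * fps_theta E4"
    unfolding divisor_series_1_3 by (simp add: E4_altdef algebra_simps)
  finally show ?thesis ..
qed

text \<open>Both products contribute \<open>480 * divisor_series 7\<close>, with opposite signs, so
  no series of weight 8 survives.\<close>

lemma fps_theta_E6: "2 * fps_theta E6 = E2 * E6 - E4 ^ 2"
proof -
  have "E2 * E6 - E4 ^ 2 = 24 * (504 * (divisor_series 1 * divisor_series 5)) -
      480 * (120 * (divisor_series 3 * divisor_series 3)) -
      504 * divisor_series 5 - 480 * divisor_series 3 - 24 * divisor_series 1"
    by (simp add: E2_altdef E4_altdef E6_altdef power2_eq_square algebra_simps)
  also have "\<dots> = 2 * fps_theta E6"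
    unfolding divisor_series_1_5 divisor_series_3_3 by (simp add: E6_altdef algebra_simps)
  finally show ?thesis ..
qed

section \<open>Modular forms\<close>

lemma modular_forms_0 [simp]: "0 \<in> modular_forms w"
  by (simp add: modular_forms_def cfps.span_zero)

lemma modular_forms_add: "f \<in> modular_forms w \<Longrightarrow> g \<in> modular_forms w \<Longrightarrow> f + g \<in> modular_forms w"
  by (simp add: modular_forms_def cfps.span_add)

lemma modular_forms_diff: "f \<in> modular_forms w \<Longrightarrow> g \<in> modular_forms w \<Longrightarrow> f - g \<in> modular_forms w"
  by (simp add: modular_forms_def cfps.span_diff)

lemma modular_forms_scale: "f \<in> modular_forms w \<Longrightarrow> fps_const c * f \<in> modular_forms w"
  by (simp add: modular_forms_def cfps.span_scale)

lemma modular_forms_sum: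
  "(\<And>i. i \<in> A \<Longrightarrow> f i \<in> modular_forms w) \<Longrightarrow> sum f A \<in> modular_forms w"
  by (simp add: modular_forms_def cfps.span_sum)

lemma modular_forms_monomial:
  "4 * int b + 6 * int c = w \<Longrightarrow> E4 ^ b * E6 ^ c \<in> modular_forms w"
  unfolding modular_forms_def by (rule cfps.span_base) blast

lemma modular_forms_1 [simp]: "1 \<in> modular_forms 0"
  using modular_forms_monomial[of 0 0] by simp

lemma modular_forms_E4 [simp]: "E4 \<in> modular_forms 4"
  using modular_forms_monomial[of 1 0] by simp

lemma modular_forms_E6 [simp]: "E6 \<in> modular_forms 6"
  using modular_forms_monomial[of 0 1] by simp

lemma modular_forms_induct [consumes 1, case_names monomial zero add scale]:
  assumes "f \<in> modular_forms w"
    and "\<And>b c. 4 * int b + 6 * int c = w \<Longrightarrow> P (E4 ^ b * E6 ^ c)"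
    and "P 0" "\<And>f g. P f \<Longrightarrow> P g \<Longrightarrow> P (f + g)" "\<And>c f. P f \<Longrightarrow> P (fps_const c * f)"
  shows "P f"
proof -
  have "cfps.subspace (Collect P)"
    using assms(3-5) by (auto simp: cfps.subspace_def)
  with assms(1) show ?thesis
    unfolding modular_forms_def by (rule cfps.span_induct) (use assms(2) in auto)
qed

lemma modular_forms_mult:
  assumes "f \<in> modular_forms w" "g \<in> modular_forms w'"
  shows "f * g \<in> modular_forms (w + w')"
  using assms(1)
proof (induction rule: modular_forms_induct)
  case (monomial b c)
  from assms(2) show ?case
  proof (induction rule: modular_forms_induct)
    case (monomial b' c')
    have "E4 ^ b * E6 ^ c * (E4 ^ b' * E6 ^ c') = E4 ^ (b + b') * E6 ^ (c + c')"
      by (simp add: power_add)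
    with monomial \<open>4 * int b + 6 * int c = w\<close> show ?case
      by (simp add: modular_forms_monomial)
  next
    case (scale a g)
    have eq: "E4 ^ b * E6 ^ c * (fps_const a * g) = fps_const a * (E4 ^ b * E6 ^ c * g)"
      by (simp add: ac_simps)
    show ?case
      unfolding eq using scale.IH by (rule modular_forms_scale)
  qed (simp_all add: distrib_left modular_forms_add)
qed (simp_all add: distrib_right mult.assoc modular_forms_add modular_forms_scale)

lemma modular_forms_power: "f \<in> modular_forms w \<Longrightarrow> f ^ n \<in> modular_forms (int n * w)"
  by (induction n) (auto simp: distrib_right dest: modular_forms_mult)

lemma modular_forms_prod:
  assumes "\<And>i. i \<in> A \<Longrightarrow> f i \<in> modular_forms (k i)"
  shows "prod f A \<in> modular_forms (sum k A)"
  using assms by (induction A rule: infinite_finite_induct) (auto intro: modular_forms_mult)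

section \<open>The Serre derivative\<close>

definition serre_derivative :: "int \<Rightarrow> complex fps \<Rightarrow> complex fps"
  where "serre_derivative w f = fps_theta f - fps_const (of_int w / 12) * E2 * f"

lemma fps_const_mult_cancel_numeral:
  fixes f g :: "complex fps"
  assumes "numeral k * f = g"
  shows "f = fps_const (1 / numeral k) * g"
proof -
  have "fps_const (1 / numeral k) * numeral k = (1 :: complex fps)"
    by (simp add: numeral_fps_const)
  then show ?thesis
    by (metis assms mult.assoc mult_1)
qed

text \<open>The terms with \<open>E2\<close> coming from the two powers add up to
  \<open>b / 3 + c / 2\<close>, which is one twelfth of the weight, and cancel against the
  correction. The truncated exponents \<open>b - 1\<close> and \<open>c - 1\<close> are harmless
  since their coefficients vanish at 0.\<close>

lemma serre_derivative_monomial: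
  "serre_derivative (4 * int b + 6 * int c) (E4 ^ b * E6 ^ c) =
    - fps_const (of_nat b / 3) * (E4 ^ (b - 1) * E6 ^ (c + 1)) -
      fps_const (of_nat c / 2) * (E4 ^ (b + 2) * E6 ^ (c - 1))"
proof -
  have E4: "fps_theta (E4 ^ b) =
      fps_const (of_nat b / 3) * (E2 * E4 ^ b - E4 ^ (b - 1) * E6)"
  proof (cases b)
    case (Suc n)
    have "fps_const (of_nat b / 3 :: complex) = of_nat b * fps_const (1 / 3)"
      by (simp add: fps_of_nat[symmetric] del: fps_of_nat)
    then show ?thesis
      unfolding fps_theta_power fps_const_mult_cancel_numeral[OF fps_theta_E4]
      by (simp add: Suc algebra_simps power2_eq_square)
  qed simp
  have E6: "fps_theta (E6 ^ c) =
      fps_const (of_nat c / 2) * (E2 * E6 ^ c - E4 ^ 2 * E6 ^ (c - 1))"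
  proof (cases c)
    case (Suc n)
    have "fps_const (of_nat c / 2 :: complex) = of_nat c * fps_const (1 / 2)"
      by (simp add: fps_of_nat[symmetric] del: fps_of_nat)
    then show ?thesis
      unfolding fps_theta_power fps_const_mult_cancel_numeral[OF fps_theta_E6]
      by (simp add: Suc algebra_simps power2_eq_square)
  qed simp
  have w: "fps_const (of_int (4 * int b + 6 * int c) / 12 :: complex) =
      fps_const (of_nat b / 3) + fps_const (of_nat c / 2)"
    unfolding fps_const_add by (rule arg_cong[where f = fps_const]) (simp add: field_simps)
  show ?thesis
    unfolding serre_derivative_def w fps_theta_mult E4 E6
    by (simp add: algebra_simps power_add power2_eq_square del: fps_const_add fps_const_neg)
qed

lemma serre_derivative_modular_forms:
  assumes "f \<in> modular_forms w"
  shows "serre_derivative w f \<in> modular_forms (w + 2)"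
  using assms
proof (induction rule: modular_forms_induct)
  case (monomial b c)
  have "fps_const (- of_nat b / 3) * (E4 ^ (b - 1) * E6 ^ (c + 1)) \<in> modular_forms (w + 2)"
  proof (cases b)
    case (Suc n)
    then show ?thesis
      using monomial by (intro modular_forms_scale modular_forms_monomial) simp
  qed simp
  moreover have "fps_const (of_nat c / 2) * (E4 ^ (b + 2) * E6 ^ (c - 1)) \<in> modular_forms (w + 2)"
  proof (cases c)
    case (Suc n)
    then show ?thesis
      using monomial by (intro modular_forms_scale modular_forms_monomial) simp
  qed simp
  moreover have "- fps_const (of_nat b / 3 :: complex) = fps_const (- of_nat b / 3)" for b
    by simp
  ultimately show ?case
    unfolding monomial[symmetric] serre_derivative_monomial
    by (metis modular_forms_diff)
next
  case (add f g)
  then show ?case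
    using modular_forms_add by (fastforce simp: serre_derivative_def algebra_simps)
next
  case (scale c f)
  have "serre_derivative w (fps_const c * f) = fps_const c * serre_derivative w f"
    by (simp add: serre_derivative_def algebra_simps)
  with scale show ?case
    by (simp add: modular_forms_scale)
qed (simp add: serre_derivative_def)

section \<open>Families of power series with orders 0, 1, ..., N - 1\<close>

lemma echelon_coefficients_0:
  fixes B :: "nat \<Rightarrow> complex fps" and c :: "nat \<Rightarrow> complex"
  assumes "\<And>k. k < N \<Longrightarrow> B k \<noteq> 0 \<and> subdegree (B k) = k"
    and "\<And>m. m < N \<Longrightarrow> fps_nth (\<Sum>k<N. fps_const (c k) * B k) m = 0"
    and "k < N"
  shows "c k = 0"
  using \<open>k < N\<close>
proof (induction k rule: less_induct)
  case (less m)
  \<comment> \<open>The coefficient of \<open>q ^ m\<close> sees only \<open>B m\<close>: smaller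
    indices have coefficient 0 by induction, larger ones vanish to higher order.\<close>
  have "0 = (\<Sum>k<N. c k * fps_nth (B k) m)"
    using assms(2)[OF less.prems] unfolding fps_sum_nth fps_mult_left_const_nth by (rule sym)
  also have "\<dots> = (\<Sum>k\<in>{m}. c k * fps_nth (B k) m)"
  proof (rule sum.mono_neutral_right)
    show "\<forall>i\<in>{..<N} - {m}. c i * fps_nth (B i) m = 0"
    proof
      fix i assume i: "i \<in> {..<N} - {m}"
      show "c i * fps_nth (B i) m = 0"
      proof (cases "i < m")
        case True
        with less.IH[of i] i show ?thesis
          by simp
      next
        case False
        with i assms(1)[of i] have "m < subdegree (B i)"
          by simp
        from nth_less_subdegree_zero[OF this] show ?thesis
          by (simp only: mult_zero_right)
      qed
    qed
  qed (use less.prems in auto)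
  finally have "c m * fps_nth (B m) m = 0"
    by simp
  moreover have "fps_nth (B m) m \<noteq> 0"
    using assms(1)[OF less.prems] nth_subdegree_nonzero[of "B m"] by simp
  ultimately show ?case
    by simp
qed

context
  fixes B :: "nat \<Rightarrow> complex fps" and N :: nat
  assumes B: "\<And>k. k < N \<Longrightarrow> B k \<noteq> 0 \<and> subdegree (B k) = k"
begin

lemma echelon_inj_on: "inj_on B {..<N}"
  using B by (metis inj_onI lessThan_iff)

lemma echelon_independent: "cfps.independent (B ` {..<N})"
proof (rule cfps.independent_if_scalars_zero)
  fix c and f assume *: "(\<Sum>f\<in>B ` {..<N}. fps_const (c f) * f) = 0" "f \<in> B ` {..<N}"
  then obtain k where k: "k < N" "f = B k"
    by blast
  from *(1) have "(\<Sum>k<N. fps_const (c (B k)) * B k) = 0"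
    by (simp add: sum.reindex[OF echelon_inj_on])
  then show "c f = 0"
    using echelon_coefficients_0[OF B, where c = "\<lambda>k. c (B k)" and k = k] k by simp
qed simp

lemma echelon_dim: "cfps.dim (cfps.span (B ` {..<N})) = N"
  using cfps.dim_span_eq_card_independent[OF echelon_independent]
  by (simp add: card_image[OF echelon_inj_on])

text \<open>A combination vanishing to order \<open>N\<close> has all its first \<open>N\<close>
  coefficients zero, which already forces every scalar to be 0.\<close>

lemma echelon_subdegree:
  assumes "f \<in> cfps.span (B ` {..<N})" "f \<noteq> 0"
  shows "subdegree f < N"
proof (rule ccontr)
  assume ge: "\<not> subdegree f < N"
  obtain u where "f = (\<Sum>v\<in>B ` {..<N}. fps_const (u v) * v)"
    using assms(1) by (auto simp: cfps.span_finite)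
  then have f: "f = (\<Sum>k<N. fps_const (u (B k)) * B k)"
    by (simp add: sum.reindex[OF echelon_inj_on])
  have "u (B k) = 0" if "k < N" for k
  proof (rule echelon_coefficients_0[OF B _ that, where c = "\<lambda>k. u (B k)"])
    fix m assume "m < N"
    with ge have "m < subdegree f"
      by simp
    then show "fps_nth (\<Sum>k<N. fps_const (u (B k)) * B k) m = 0"
      unfolding f[symmetric] by (rule nth_less_subdegree_zero)
  qed
  with f \<open>f \<noteq> 0\<close> show False
    by simp
qed

end

section \<open>The discriminant and the dimensions of the spaces of modular forms\<close>

lemma fps_nth_E4 [simp]: "fps_nth E4 0 = 1" "fps_nth E4 (Suc 0) = 240"
  and fps_nth_E6 [simp]: "fps_nth E6 0 = 1" "fps_nth E6 (Suc 0) = - 504"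
  by (simp_all add: E4_def E6_def divisor_sigma_def)

text \<open>1728 times the modular discriminant\<close>

definition discriminant :: "complex fps"
  where "discriminant = E4 ^ 3 - E6 ^ 2"

lemma discriminant_modular_forms [simp]: "discriminant \<in> modular_forms 12"
  unfolding discriminant_def
  using modular_forms_power[OF modular_forms_E4, of 3] modular_forms_power[OF modular_forms_E6, of 2]
  by (simp add: modular_forms_diff)

text \<open>The constant terms cancel, and the coefficient of \<open>q\<close> is
  \<open>3 * 240 + 2 * 504 = 1728\<close>.\<close>

lemma subdegree_discriminant [simp]: "subdegree discriminant = 1"
  by (rule subdegreeI) (simp_all add: discriminant_def fps_mult_nth power_numeral_reduce)

lemma discriminant_nonzero [simp]: "discriminant \<noteq> 0"
  using subdegree_discriminant by fastforce

text \<open>Trading a factor \<open>E4 ^ 3\<close> for the discriminant keeps the weight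
  \<open>4 * a + 6 * b + 12 * n\<close> and raises the order by one; this is meant for
  \<open>k \<le> n\<close>.\<close>

definition modular_basis :: "nat \<Rightarrow> nat \<Rightarrow> nat \<Rightarrow> nat \<Rightarrow> complex fps"
  where "modular_basis a b n k = E4 ^ (a + 3 * (n - k)) * E6 ^ b * discriminant ^ k"

lemma modular_basis_echelon: "modular_basis a b n k \<noteq> 0 \<and> subdegree (modular_basis a b n k) = k"
proof -
  have [simp]: "E4 \<noteq> 0" "E6 \<noteq> 0"
    using fps_nth_E4(1) fps_nth_E6(1) by force+
  show ?thesis
    by (simp add: modular_basis_def subdegree_mult subdegree_power)
qed

text \<open>Rewriting \<open>E6 ^ 2\<close> as \<open>E4 ^ 3 - discriminant\<close> removes pairs of
  factors \<open>E6\<close> one at a time, until only the exponent \<open>b \<le> 1\<close> is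
  left.\<close>

lemma modular_forms_eq_span:
  assumes "a \<le> 2" "b \<le> 1" "w = 4 * int a + 6 * int b + 12 * int n"
  shows "modular_forms w = cfps.span (modular_basis a b n ` {..<Suc n})"
proof
  have mem: "E4 ^ (a + 3 * i) * E6 ^ (b + 2 * j) * discriminant ^ k
      \<in> cfps.span (modular_basis a b n ` {..<Suc n})" if "i + j + k = n" for i j k
    using that
  proof (induction j arbitrary: i k)
    case 0
    then show ?case
      by (intro cfps.span_base image_eqI[of _ _ k]) (auto simp: modular_basis_def)
  next
    case (Suc j)
    have "E4 ^ (a + 3 * i) * E6 ^ (b + 2 * Suc j) * discriminant ^ k =
        E4 ^ (a + 3 * Suc i) * E6 ^ (b + 2 * j) * discriminant ^ k -
        E4 ^ (a + 3 * i) * E6 ^ (b + 2 * j) * discriminant ^ Suc k"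
      by (simp add: discriminant_def power_add power_mult algebra_simps power_numeral_reduce)
    moreover have "E4 ^ (a + 3 * Suc i) * E6 ^ (b + 2 * j) * discriminant ^ k
        \<in> cfps.span (modular_basis a b n ` {..<Suc n})"
      using Suc.prems by (intro Suc.IH) simp
    moreover have "E4 ^ (a + 3 * i) * E6 ^ (b + 2 * j) * discriminant ^ Suc k
        \<in> cfps.span (modular_basis a b n ` {..<Suc n})"
      using Suc.prems by (intro Suc.IH) simp
    ultimately show ?case
      by (metis cfps.span_diff)
  qed
  have "E4 ^ b' * E6 ^ c' \<in> cfps.span (modular_basis a b n ` {..<Suc n})"
    if w': "4 * int b' + 6 * int c' = w" for b' c'
  proof -
    define i j r s where "i = b' div 3" "j = c' div 2" "r = b' mod 3" "s = c' mod 2"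
    then have ij: "b' = r + 3 * i" "c' = s + 2 * j" and rs: "r \<in> {0, 1, 2}" "s \<in> {0, 1}"
      by (auto simp: less_2_cases_iff)
    have eq: "(2 * r + 3 * s) + 6 * (i + j) = (2 * a + 3 * b) + 6 * n"
      using w' assms(3) by (simp add: ij)
    \<comment> \<open>By the Chinese remainder theorem \<open>2 * r + 3 * s\<close> modulo 6
      determines \<open>r\<close> modulo 3 and \<open>s\<close> modulo 2.\<close>
    then have "(2 * r + 3 * s) mod 6 = (2 * a + 3 * b) mod 6"
      by (metis mod_mult_self2)
    moreover have "a \<in> {0, 1, 2}" "b \<in> {0, 1}"
      using assms(1,2) by auto
    ultimately have "r = a" "s = b"
      using rs by auto
    with ij eq have "b' = a + 3 * i" "c' = b + 2 * j" "i + j = n"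
      by simp_all
    then show ?thesis
      using mem[of i j 0] by simp
  qed
  then show "modular_forms w \<subseteq> cfps.span (modular_basis a b n ` {..<Suc n})"
    unfolding modular_forms_def by (intro cfps.span_minimal) (auto simp: cfps.subspace_span)
  show "cfps.span (modular_basis a b n ` {..<Suc n}) \<subseteq> modular_forms w"
  proof (rule cfps.span_minimal)
    show "modular_basis a b n ` {..<Suc n} \<subseteq> modular_forms w"
    proof safe
      fix k assume "k < Suc n"
      then have "w = int (a + 3 * (n - k)) * 4 + int b * 6 + int k * 12"
        using assms(3) by (simp add: of_nat_diff)
      then show "modular_basis a b n k \<in> modular_forms w"
        unfolding modular_basis_def
        by (simp only:) (intro modular_forms_mult modular_forms_power; simp)
    qed
  qed (simp add: modular_forms_def cfps.subspace_span)
qed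

lemma dim_modular_basis:
  assumes "a \<le> 2" "b \<le> 1" "w = 4 * int a + 6 * int b + 12 * int n"
  shows "dim_modular w = Suc n"
  unfolding dim_modular_def modular_forms_eq_span[OF assms]
  by (rule echelon_dim[OF modular_basis_echelon])

text \<open>Left untruncated at negative weights, so that adding 12 to any integer weight adds
  exactly 1.\<close>

definition dim_formula :: "int \<Rightarrow> int"
  where "dim_formula w = (if w mod 12 = 2 then w div 12 else w div 12 + 1)"

lemma modular_forms_trivial:
  assumes "w < 0 \<or> odd w \<or> w = 2"
  shows "modular_forms w = {0}"
proof -
  have "4 * int b + 6 * int c \<noteq> w" for b c
    using assms by presburger
  then have "{E4 ^ b * E6 ^ c | b c. 4 * int b + 6 * int c = w} = {}"
    by blast
  then show ?thesis
    by (simp add: modular_forms_def)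
qed

lemma weight_decomposition:
  fixes w :: int
  assumes "even w" "w \<ge> 0" "w \<noteq> 2"
  obtains a b n :: nat where "a \<le> 2" "b \<le> 1" "w = 4 * int a + 6 * int b + 12 * int n"
    "dim_formula w = int n + 1"
proof -
  define q where "q = w div 12"
  have "w mod 12 \<in> {0, 2, 4, 6, 8, 10}"
    using assms(1) by (simp, presburger)
  moreover have "w = 12 * q + w mod 12" "q \<ge> 0"
    using assms(2) by (simp_all add: q_def)
  ultimately consider "w = 12 * q" "w mod 12 = 0" | "w = 12 * q + 2" "w mod 12 = 2"
    | "w = 12 * q + 4" "w mod 12 = 4" | "w = 12 * q + 6" "w mod 12 = 6"
    | "w = 12 * q + 8" "w mod 12 = 8" | "w = 12 * q + 10" "w mod 12 = 10"
    by auto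
  then show ?thesis
  proof cases
    case 1
    then show ?thesis
      using \<open>q \<ge> 0\<close> by (intro that[of 0 0 "nat q"]) (simp_all add: dim_formula_def)
  next
    \<comment> \<open>The residue 2 is not \<open>4 * a + 6 * b\<close>, but
      \<open>14 = 4 * 2 + 6\<close> is, so one multiple of 12 is borrowed; this lowers the dimension
      by one and fails only for \<open>w = 2\<close>.\<close>
    case 2
    then show ?thesis
      using \<open>q \<ge> 0\<close> assms(3)
      by (intro that[of 2 1 "nat (q - 1)"]) (simp_all add: dim_formula_def)
  next
    case 3
    then show ?thesis
      using \<open>q \<ge> 0\<close> by (intro that[of 1 0 "nat q"]) (simp_all add: dim_formula_def)
  next
    case 4
    then show ?thesis
      using \<open>q \<ge> 0\<close> by (intro that[of 0 1 "nat q"]) (simp_all add: dim_formula_def)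
  next
    case 5
    then show ?thesis
      using \<open>q \<ge> 0\<close> by (intro that[of 2 0 "nat q"]) (simp_all add: dim_formula_def)
  next
    case 6
    then show ?thesis
      using \<open>q \<ge> 0\<close> by (intro that[of 1 1 "nat q"]) (simp_all add: dim_formula_def)
  qed
qed

lemma dim_modular_eq: "int (dim_modular w) = (if w < 0 \<or> odd w then 0 else dim_formula w)"
proof (cases "w < 0 \<or> odd w \<or> w = 2")
  case True
  moreover have "cfps.dim {0} = 0"
    using cfps.dim_span_eq_card_independent[OF cfps.independent_empty] by simp
  ultimately show ?thesis
    by (auto simp: dim_modular_def modular_forms_trivial dim_formula_def)
next
  case False
  then have "even w" "w \<ge> 0" "w \<noteq> 2"
    by auto
  from weight_decomposition[OF this] obtain a b n
    where *: "a \<le> 2" "b \<le> 1" "w = 4 * int a + 6 * int b + 12 * int n"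
    and n: "dim_formula w = int n + 1"
    by metis
  then show ?thesis
    using dim_modular_basis[OF *] False n by simp
qed

text \<open>Takes the place of the valence formula: the basis elements have orders 0, ...,
  \<open>n\<close>, one for each dimension.\<close>

lemma subdegree_less_dim_modular:
  assumes "f \<in> modular_forms w" "f \<noteq> 0"
  shows "subdegree f < dim_modular w"
proof -
  have "even w" "w \<ge> 0" "w \<noteq> 2"
    using assms modular_forms_trivial[of w] by fastforce+
  from weight_decomposition[OF this] obtain a b n
    where *: "a \<le> 2" "b \<le> 1" "w = 4 * int a + 6 * int b + 12 * int n"
    by metis
  from assms(1) have "f \<in> cfps.span (modular_basis a b n ` {..<Suc n})"
    unfolding modular_forms_eq_span[OF *] .
  from echelon_subdegree[OF modular_basis_echelon this assms(2)] show ?thesis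
    unfolding dim_modular_basis[OF *] .
qed

section \<open>Unipotent connections\<close>

text \<open>If \<open>a\<close> were nonzero, the equation would say that \<open>q d/dq\<close> maps
  the Laurent series \<open>b / a\<close> to the constant \<open>c\<close>, but the image of a
  Laurent series has constant term 0. The proof compares lowest coefficients to stay among power
  series.\<close>

lemma fps_theta_logarithmic:
  fixes a b :: "complex fps"
  assumes "a * fps_theta b - b * fps_theta a = fps_const c * a ^ 2" "c \<noteq> 0"
  shows "a = 0"
proof (rule ccontr)
  assume a: "a \<noteq> 0"
  define m where "m = subdegree a"
  have am: "fps_nth a m \<noteq> 0"
    using a by (simp add: m_def nth_subdegree_nonzero)
  have prod: "fps_nth (f * g) (i + j) = fps_nth f i * fps_nth g j"
    if "\<And>k. k < i \<Longrightarrow> fps_nth f k = 0" "\<And>k. k < j \<Longrightarrow> fps_nth g k = 0"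
    for f g :: "complex fps" and i j
  proof -
    have "fps_nth (f * g) (i + j) = (\<Sum>k\<in>{0..i + j}. fps_nth f k * fps_nth g (i + j - k))"
      by (simp add: fps_mult_nth)
    also have "\<dots> = (\<Sum>k\<in>{i}. fps_nth f k * fps_nth g (i + j - k))"
    proof (rule sum.mono_neutral_right)
      show "\<forall>k\<in>{0..i + j} - {i}. fps_nth f k * fps_nth g (i + j - k) = 0"
      proof
        fix k assume k: "k \<in> {0..i + j} - {i}"
        show "fps_nth f k * fps_nth g (i + j - k) = 0"
        proof (cases "k < i")
          case True
          from that(1)[OF this] show ?thesis
            by (simp only: mult_zero_left)
        next
          case False
          with k have "i + j - k < j"
            by auto
          from that(2)[OF this] show ?thesis
            by (simp only: mult_zero_right)
        qed
      qed
    qed simp_all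
    finally show ?thesis
      by simp
  qed
  have low: "fps_nth a k = 0" if "k < m" for k
    using that unfolding m_def by (rule nth_less_subdegree_zero)
  have low': "fps_nth (fps_theta f) k = 0" if "fps_nth f k = 0" for f :: "complex fps" and k
    using that by simp
  show False
  proof (cases "\<forall>k<m. fps_nth b k = 0")
    \<comment> \<open>At \<open>q ^ (2 * m)\<close> the two terms on the left cancel, while the
      right side has \<open>c * fps_nth a m ^ 2\<close>.\<close>
    case True
    have "fps_nth (a * fps_theta b - b * fps_theta a) (m + m) = 0"
      using True low by (simp add: prod)
    moreover have "fps_nth (fps_const c * a ^ 2) (m + m) = c * fps_nth a m ^ 2"
      unfolding power2_eq_square fps_mult_left_const_nth by (subst prod) (use low in auto)
    ultimately show False
      using assms am by simp
  next
    \<comment> \<open>Here \<open>b\<close> has order \<open>j < m\<close>. At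
      \<open>q ^ (m + j)\<close> the left side is \<open>j - m\<close> times the product of the
      leading coefficients, and \<open>a ^ 2\<close> contributes nothing.\<close>
    case False
    define j where "j = (LEAST k. fps_nth b k \<noteq> 0)"
    have bj: "fps_nth b j \<noteq> 0"
      unfolding j_def using False by (metis (mono_tags, lifting) LeastI)
    have lowj: "fps_nth b k = 0" if "k < j" for k
      using not_less_Least[of k "\<lambda>k. fps_nth b k \<noteq> 0"] that unfolding j_def by blast
    obtain k where "k < m" "fps_nth b k \<noteq> 0"
      using False by blast
    then have "j < m"
      using lowj[of k] by (cases "k < j") auto
    have "fps_nth (a * fps_theta b) (m + j) = of_nat j * (fps_nth a m * fps_nth b j)"
      by (subst prod) (use low lowj in auto)
    moreover have "fps_nth (b * fps_theta a) (j + m) = of_nat m * (fps_nth a m * fps_nth b j)"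
      by (subst prod) (use low lowj in auto)
    moreover have "fps_nth (fps_const c * a ^ 2) (m + j) = 0"
    proof -
      have "fps_nth (a * a) (m + j) = fps_nth a m * fps_nth a j"
        by (rule prod) (use low \<open>j < m\<close> in auto)
      then show ?thesis
        using low[OF \<open>j < m\<close>] by (simp add: power2_eq_square)
    qed
    ultimately have "(of_nat j - of_nat m) * (fps_nth a m * fps_nth b j) = 0"
      using assms(1)[THEN arg_cong, of "\<lambda>f. fps_nth f (m + j)"]
      by (simp add: algebra_simps)
    then show False
      using am bj \<open>j < m\<close> by simp
  qed
qed

text \<open>
  The array \<open>v k j\<close> contains the coordinates of the iterated derivatives of a vector under a
  connection with maximal unipotent residue, up to the scalar terms \<open>s k\<close>. Such a connection has a
  single invariant flag, so a vector outside of its top step is cyclic.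
\<close>

locale unipotent_iteration =
  fixes l :: nat and \<beta> :: "nat \<Rightarrow> complex" and s :: "nat \<Rightarrow> complex fps"
    and v :: "nat \<Rightarrow> nat \<Rightarrow> complex fps"
  assumes \<beta>: "\<And>j. j < l \<Longrightarrow> \<beta> j \<noteq> 0"
    and v_0: "\<And>k. v (Suc k) 0 = fps_theta (v k 0) + s k * v k 0"
    and v_Suc: "\<And>k j. v (Suc k) (Suc j) =
      fps_theta (v k (Suc j)) + fps_const (\<beta> j) * v k j + s k * v k (Suc j)"
begin

definition annihilator :: "(nat \<Rightarrow> complex fps) \<Rightarrow> bool"
  where "annihilator \<phi> \<longleftrightarrow> (\<forall>k. (\<Sum>j\<le>l. \<phi> j * v k j) = 0)"

text \<open>Differentiating the relation and inserting the recursion for \<open>v\<close> shows that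
  annihilators are stable under the dual connection; the terms with \<open>s k\<close> are multiples
  of the relation itself. The multipliers \<open>a\<close> and \<open>b\<close> permit elimination
  without division.\<close>

lemma annihilator_step:
  assumes "annihilator \<phi>"
  shows "annihilator (\<lambda>j. a * (fps_theta (\<phi> j) - (if j < l then fps_const (\<beta> j) * \<phi> (Suc j) else 0))
    - b * \<phi> j)"
  unfolding annihilator_def
proof
  fix k
  have ann: "(\<Sum>j\<le>l. \<phi> j * v k j) = 0" for k
    using assms by (simp add: annihilator_def)
  have "0 = fps_theta (\<Sum>j\<le>l. \<phi> j * v k j)"
    by (simp add: ann)
  also have "\<dots> = (\<Sum>j\<le>l. fps_theta (\<phi> j) * v k j) + (\<Sum>j\<le>l. \<phi> j * fps_theta (v k j))"
    by (simp add: fps_theta_sum sum.distrib add.commute)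
  also have "(\<Sum>j\<le>l. \<phi> j * fps_theta (v k j)) = (\<Sum>j\<le>l. \<phi> j * v (Suc k) j) -
      s k * (\<Sum>j\<le>l. \<phi> j * v k j) - (\<Sum>j<l. fps_const (\<beta> j) * \<phi> (Suc j) * v k j)"
  proof -
    have "(\<Sum>j\<le>l. \<phi> j * v (Suc k) j) =
        \<phi> 0 * v (Suc k) 0 + (\<Sum>j<l. \<phi> (Suc j) * v (Suc k) (Suc j))"
      by (simp add: sum.atMost_shift)
    moreover have "(\<Sum>j\<le>l. \<phi> j * fps_theta (v k j)) =
        \<phi> 0 * fps_theta (v k 0) + (\<Sum>j<l. \<phi> (Suc j) * fps_theta (v k (Suc j)))"
      by (simp add: sum.atMost_shift)
    moreover have "(\<Sum>j\<le>l. \<phi> j * v k j) =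
        \<phi> 0 * v k 0 + (\<Sum>j<l. \<phi> (Suc j) * v k (Suc j))"
      by (simp add: sum.atMost_shift)
    ultimately show ?thesis
      by (simp add: v_0 v_Suc algebra_simps sum.distrib sum_distrib_left)
  qed
  also have "(\<Sum>j<l. fps_const (\<beta> j) * \<phi> (Suc j) * v k j) =
      (\<Sum>j\<le>l. (if j < l then fps_const (\<beta> j) * \<phi> (Suc j) else 0) * v k j)"
    by (simp add: lessThan_Suc_atMost[symmetric])
  finally have eq: "(\<Sum>j\<le>l. fps_theta (\<phi> j) * v k j) =
      (\<Sum>j\<le>l. (if j < l then fps_const (\<beta> j) * \<phi> (Suc j) else 0) * v k j)"
    by (simp add: ann)
  have "(\<Sum>j\<le>l. (a * (fps_theta (\<phi> j) - (if j < l then fps_const (\<beta> j) * \<phi> (Suc j) else 0))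
      - b * \<phi> j) * v k j) = a * ((\<Sum>j\<le>l. fps_theta (\<phi> j) * v k j) -
        (\<Sum>j\<le>l. (if j < l then fps_const (\<beta> j) * \<phi> (Suc j) else 0) * v k j)) -
        b * (\<Sum>j\<le>l. \<phi> j * v k j)"
    unfolding sum_distrib_left sum_subtractf[symmetric]
    by (rule sum.cong) (simp_all add: algebra_simps)
  then show "(\<Sum>j\<le>l. (a * (fps_theta (\<phi> j) - (if j < l then fps_const (\<beta> j) * \<phi> (Suc j) else 0))
      - b * \<phi> j) * v k j) = 0"
    unfolding eq ann by simp
qed

text \<open>\<open>J\<close> bounds the support of \<open>\<phi>\<close>. If \<open>\<phi>\<close>
  ended at a positive index \<open>J\<close>, the dual connection would give an annihilator with
  shorter support, which is 0 by induction, and its component at \<open>J - 1\<close> is the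
  equation excluded by \<open>fps_theta_logarithmic\<close>. If it ended at 0, the product
  \<open>\<phi> 0 * v 0 0\<close> would vanish.\<close>

lemma annihilator_0:
  assumes "annihilator \<phi>" "v 0 0 \<noteq> 0" "\<And>j. J \<le> j \<Longrightarrow> j \<le> l \<Longrightarrow> \<phi> j = 0" "j \<le> l"
  shows "\<phi> j = 0"
  using assms(1,3,4)
proof (induction J arbitrary: \<phi> j)
  case 0
  then show ?case
    by simp
next
  case (Suc J)
  note IH = Suc.IH and ann = Suc.prems(1) and zero = Suc.prems(2) and j = Suc.prems(3)
  have zero': "\<phi> i = 0" if "J < i" "i \<le> l" for i
    using that by (intro zero) simp_all
  have J: "\<phi> J = 0" if "J \<le> l"
  proof (cases J)
    case 0
    have "(\<Sum>j\<le>l. \<phi> j * v 0 j) = (\<Sum>j\<in>{0}. \<phi> j * v 0 j)"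
      by (rule sum.mono_neutral_right) (simp_all add: zero' 0)
    then show ?thesis
      using ann assms(2) 0 by (simp add: annihilator_def)
  next
    case (Suc p)
    \<comment> \<open>The multipliers \<open>\<phi> J\<close> and
      \<open>fps_theta (\<phi> J)\<close> are chosen to cancel the component at
      \<open>J\<close>.\<close>
    define \<psi> where "\<psi> j = \<phi> J * (fps_theta (\<phi> j) -
      (if j < l then fps_const (\<beta> j) * \<phi> (Suc j) else 0)) - fps_theta (\<phi> J) * \<phi> j" for j
    have "annihilator \<psi>"
      unfolding \<psi>_def using ann by (rule annihilator_step)
    moreover have "\<psi> i = 0" if "J \<le> i" "i \<le> l" for i
    proof (cases "i = J")
      case True
      have "(if J < l then fps_const (\<beta> J) * \<phi> (Suc J) else 0) = 0"
        using zero'[of "Suc J"] by simp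
      then show ?thesis
        unfolding \<psi>_def True by simp
    next
      case False
      then have "J < i"
        using that by simp
      then show ?thesis
        using that zero'[of i] zero'[of "Suc i"] by (simp add: \<psi>_def)
    qed
    moreover have "p \<le> l" "p < l"
      using \<open>J \<le> l\<close> Suc by simp_all
    ultimately have "\<psi> p = 0"
      by (metis IH)
    then have "\<phi> J * fps_theta (\<phi> p) - \<phi> p * fps_theta (\<phi> J) = fps_const (\<beta> p) * \<phi> J ^ 2"
      unfolding \<psi>_def using \<open>p < l\<close> by (simp add: Suc power2_eq_square algebra_simps)
    then show ?thesis
      using \<beta>[OF \<open>p < l\<close>] by (rule fps_theta_logarithmic)
  qed
  have "\<phi> i = 0" if "J \<le> i" "i \<le> l" for i
    using J zero'[of i] that by (cases "i = J") auto
  with ann j show ?case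
    by (metis IH)
qed

text \<open>The derivative of a relation is again a relation, one step longer. Its leading
  coefficient is unchanged, since \<open>v (Suc n)\<close> arises only from
  \<open>c n * v n\<close>; the terms with \<open>\<beta>\<close> form the relation at the previous
  coordinate.\<close>

lemma relation_Suc:
  assumes "c n = d" "\<And>j. (\<Sum>k\<le>n. c k * v k j) = 0"
  obtains c' where "c' (Suc n) = d" "\<And>j. (\<Sum>k\<le>Suc n. c' k * v k j) = 0"
proof
  define c' where "c' k = (if k \<le> n then fps_theta (c k) - s k * c k else 0) +
    (case k of 0 \<Rightarrow> 0 | Suc i \<Rightarrow> c i)" for k
  show "c' (Suc n) = d"
    by (simp add: c'_def assms(1))
  define w where "w k j = (case j of 0 \<Rightarrow> 0 | Suc i \<Rightarrow> fps_const (\<beta> i) * v k i)" for k j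
  have step: "v (Suc k) j = fps_theta (v k j) + w k j + s k * v k j" for k j
    by (cases j) (simp_all add: w_def v_0 v_Suc)
  have w: "(\<Sum>k\<le>n. c k * w k j) = 0" for j
  proof (cases j)
    case (Suc i)
    have "(\<Sum>k\<le>n. c k * w k j) = fps_const (\<beta> i) * (\<Sum>k\<le>n. c k * v k i)"
      unfolding sum_distrib_left by (rule sum.cong) (simp_all add: w_def Suc ac_simps)
    then show ?thesis
      by (simp add: assms(2))
  qed (simp add: w_def)
  fix j
  have "(\<Sum>k\<le>Suc n. c' k * v k j) =
      (\<Sum>k\<le>Suc n. (if k \<le> n then fps_theta (c k) - s k * c k else 0) * v k j) +
      (\<Sum>k\<le>Suc n. (case k of 0 \<Rightarrow> 0 | Suc i \<Rightarrow> c i) * v k j)"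
    by (simp add: c'_def distrib_right sum.distrib del: sum.atMost_Suc)
  also have "(\<Sum>k\<le>Suc n. (if k \<le> n then fps_theta (c k) - s k * c k else 0) * v k j) =
      (\<Sum>k\<le>n. (fps_theta (c k) - s k * c k) * v k j)"
    by simp
  also have "(\<Sum>k\<le>Suc n. (case k of 0 \<Rightarrow> 0 | Suc i \<Rightarrow> c i) * v k j) =
      (\<Sum>k\<le>n. c k * v (Suc k) j)"
    by (subst sum.atMost_Suc_shift) simp
  also have "(\<Sum>k\<le>n. (fps_theta (c k) - s k * c k) * v k j) + (\<Sum>k\<le>n. c k * v (Suc k) j) =
      fps_theta (\<Sum>k\<le>n. c k * v k j) + (\<Sum>k\<le>n. c k * w k j)"
    unfolding step fps_theta_sum sum.distrib[symmetric]
    by (rule sum.cong) (simp_all add: algebra_simps)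
  finally show "(\<Sum>k\<le>Suc n. c' k * v k j) = 0"
    by (simp add: w assms(2))
qed

text \<open>A relation ending at \<open>m \<le> l\<close> makes every later vector dependent on the
  first \<open>m\<close>. These are too few to exclude a nonzero annihilator, contradicting
  \<open>annihilator_0\<close>.\<close>

lemma linearly_independent:
  assumes rel: "\<And>j. (\<Sum>k\<le>l. c k * v k j) = 0" and c: "i \<le> l" "c i \<noteq> 0"
  shows "v 0 0 = 0"
proof (rule ccontr)
  assume v00: "v 0 0 \<noteq> 0"
  define m where "m = Max {k. k \<le> l \<and> c k \<noteq> 0}"
  have "m \<in> {k. k \<le> l \<and> c k \<noteq> 0}"
    unfolding m_def using c by (intro Max_in) auto
  then have m: "m \<le> l" "c m \<noteq> 0"
    by auto
  have "k \<le> m" if "k \<le> l" "c k \<noteq> 0" for k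
    unfolding m_def using that by (intro Max_ge) auto
  then have "(\<Sum>k\<le>l. c k * v k j) = (\<Sum>k\<le>m. c k * v k j)" for j
    using m by (intro sum.mono_neutral_right) force+
  then have relm: "(\<Sum>k\<le>m. c k * v k j) = 0" for j
    using rel by simp
  have relations: "\<exists>c'. c' n = c m \<and> (\<forall>j. (\<Sum>k\<le>n. c' k * v k j) = 0)" if "m \<le> n" for n
    using that
  proof (induction n rule: dec_induct)
    case base
    then show ?case
      using relm by blast
  next
    case (step n)
    then obtain c' where "c' n = c m" "\<And>j. (\<Sum>k\<le>n. c' k * v k j) = 0"
      by blast
    then show ?case
      using relation_Suc[of c' n "c m"] by metis
  qed
  \<comment> \<open>The rows from \<open>m\<close> on are filled with zeros; as
    \<open>m \<le> l\<close>, there is at least one, so a nonzero kernel vector exists.\<close>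
  define B where "B = mat (Suc l) (Suc l) (\<lambda>(k, j). if k < m then v k j else 0)"
  have B: "B \<in> carrier_mat (Suc l) (Suc l)"
    by (simp add: B_def)
  have "det B = (\<Sum>j<Suc l. B $$ (l, j) * cofactor B l j)"
    by (rule laplace_expansion_row[OF B]) simp
  also have "\<dots> = 0"
    using m by (intro sum.neutral) (simp add: B_def)
  finally have "det B = 0" .
  then obtain p where p: "p \<in> carrier_vec (Suc l)" "p \<noteq> 0\<^sub>v (Suc l)" "B *\<^sub>v p = 0\<^sub>v (Suc l)"
    using det_0_iff_vec_prod_zero[OF B] by blast
  define \<phi> where "\<phi> j = p $ j" for j
  have "(\<Sum>j\<le>l. \<phi> j * v k j) = 0" for k
  proof (induction k rule: less_induct)
    case (less k)
    show ?case
    proof (cases "k < m")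
      case True
      have "0 = (B *\<^sub>v p) $ k"
        using p(3) True m by simp
      also have "\<dots> = (\<Sum>j\<le>l. \<phi> j * v k j)"
        using True m p(1)
        by (simp add: B_def \<phi>_def scalar_prod_def mult.commute atLeast0LessThan lessThan_Suc_atMost
          del: sum.lessThan_Suc sum.op_ivl_Suc)
      finally show ?thesis ..
    next
      \<comment> \<open>The relation ending at \<open>k\<close> has the nonzero leading coefficient
        \<open>c m\<close>, and the earlier vectors are already annihilated.\<close>
      case False
      then obtain c' where c': "c' k = c m" "\<And>j. (\<Sum>i\<le>k. c' i * v i j) = 0"
        using relations[of k] by auto
      have "0 = (\<Sum>j\<le>l. \<phi> j * (\<Sum>i\<le>k. c' i * v i j))"
        by (simp add: c'(2))
      also have "\<dots> = (\<Sum>i\<le>k. c' i * (\<Sum>j\<le>l. \<phi> j * v i j))"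
        unfolding sum_distrib_left by (subst sum.swap) (simp add: ac_simps)
      also have "\<dots> = (\<Sum>i\<in>{k}. c' i * (\<Sum>j\<le>l. \<phi> j * v i j))"
        using less by (intro sum.mono_neutral_right) auto
      finally show ?thesis
        using c'(1) m by simp
    qed
  qed
  then have "annihilator \<phi>"
    by (simp add: annihilator_def)
  from annihilator_0[OF this v00, of "Suc l"] have "\<phi> j = 0" if "j \<le> l" for j
    using that by simp
  then have "p = 0\<^sub>v (Suc l)"
    using p(1) by (intro eq_vecI) (auto simp: \<phi>_def less_Suc_eq_le)
  with p(2) show False ..
qed

end

section \<open>Iterated Serre derivatives\<close>

text \<open>\<open>taylor x i j\<close> is the coefficient of \<open>Y\<^sup>j\<close> in \<open>(x + Y)\<^sup>i\<close>.\<close>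

fun taylor :: "'a::comm_ring_1 \<Rightarrow> nat \<Rightarrow> nat \<Rightarrow> 'a"
  where
    "taylor x 0 0 = 1"
  | "taylor x 0 (Suc j) = 0"
  | "taylor x (Suc i) 0 = x * taylor x i 0"
  | "taylor x (Suc i) (Suc j) = x * taylor x i (Suc j) + taylor x i j"

lemma taylor_0: "taylor x i 0 = x ^ i"
  by (induction i) simp_all

text \<open>As \<open>taylor x i j\<close> is \<open>(i choose j) * x ^ (i - j)\<close>, this is the
  absorption identity for binomial coefficients; for \<open>j > i\<close> both sides are 0.\<close>

lemma taylor_absorption:
  "of_nat (Suc j) * x * taylor x i (Suc j) = (of_nat i - of_nat j) * taylor x i j"
proof (induction i arbitrary: j)
  case 0
  show ?case
    by (cases j) simp_all
next
  case (Suc i)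
  show ?case
  proof (cases j)
    case 0
    then show ?thesis
      using Suc.IH[of 0] by (simp add: algebra_simps)
  next
    case j: (Suc p)
    have "of_nat (Suc j) * x * taylor x (Suc i) (Suc j) =
        x * (of_nat (Suc j) * x * taylor x i (Suc j)) + of_nat (Suc j) * x * taylor x i j"
      by (simp add: algebra_simps)
    also have "\<dots> = (of_nat (Suc i) - of_nat j) * x * taylor x i j +
        of_nat (Suc p) * x * taylor x i (Suc p)"
      unfolding Suc.IH[of j] by (simp add: j algebra_simps)
    also have "of_nat (Suc p) * x * taylor x i (Suc p) = (of_nat i - of_nat p) * taylor x i p"
      by (rule Suc.IH)
    also have "(of_nat (Suc i) - of_nat j) * x * taylor x i j + (of_nat i - of_nat p) * taylor x i p =
        (of_nat (Suc i) - of_nat j) * taylor x (Suc i) j"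
      by (simp add: j algebra_simps)
    finally show ?thesis .
  qed
qed

text \<open>The chain rule with \<open>12 * fps_theta E2 = E2 ^ 2 - E4\<close>: the first summand
  raises the power of \<open>E2\<close> back, the second lowers it and uses
  \<open>(i - j) * (i choose j) = i * (i - 1 choose j)\<close>.\<close>

lemma fps_theta_taylor:
  "12 * fps_theta (taylor E2 i j) = (of_nat i - of_nat j) * E2 * taylor E2 i j -
    E4 * (case i of 0 \<Rightarrow> 0 | Suc p \<Rightarrow> of_nat i * taylor E2 p j)"
proof (induction i arbitrary: j)
  case 0
  show ?case
    by (cases j) simp_all
next
  case (Suc i)
  define c where "c j = (case i of 0 \<Rightarrow> 0 | Suc p \<Rightarrow> of_nat i * taylor E2 p j)" for j
  note IH = Suc.IH[folded c_def]
  show ?case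
  proof (cases j)
    case 0
    have c: "taylor E2 i 0 + E2 * c 0 = of_nat (Suc i) * taylor E2 i 0"
      by (cases i) (simp_all add: c_def algebra_simps)
    have "12 * fps_theta (taylor E2 (Suc i) 0) =
        E2 * (12 * fps_theta (taylor E2 i 0)) + 12 * fps_theta E2 * taylor E2 i 0"
      by (simp add: algebra_simps)
    also have "\<dots> = (of_nat (Suc i) - of_nat 0) * E2 * taylor E2 (Suc i) 0 -
        E4 * (of_nat (Suc i) * taylor E2 i 0)"
      unfolding IH fps_theta_E2 c[symmetric] by (simp add: algebra_simps power2_eq_square)
    finally show ?thesis
      by (simp only: 0 nat.case)
  next
    case j: (Suc p)
    have c: "taylor E2 i j + E2 * c j + c p = of_nat (Suc i) * taylor E2 i j"
      by (cases i) (simp_all add: j c_def algebra_simps)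
    have "12 * fps_theta (taylor E2 (Suc i) j) =
        E2 * (12 * fps_theta (taylor E2 i j)) + 12 * fps_theta E2 * taylor E2 i j +
        12 * fps_theta (taylor E2 i p)"
      by (simp add: j algebra_simps)
    also have "\<dots> = (of_nat (Suc i) - of_nat j) * E2 * taylor E2 (Suc i) j -
        E4 * (of_nat (Suc i) * taylor E2 i j)"
      unfolding IH fps_theta_E2 c[symmetric] by (simp add: j algebra_simps power2_eq_square)
    finally show ?thesis
      by (simp only: nat.case)
  qed
qed

text \<open>
  The derivation of weight 2 on \<open>\<Sum>i\<le>l. u i * X ^ (l - i) * Z ^ i\<close>, with \<open>u i\<close> of weight \<open>m - 2 i\<close>,
  which acts as the Serre derivative on coefficients and by
  \<open>X \<mapsto> Z / 12\<close>, \<open>Z \<mapsto> - E4 * X / 12\<close> on the variables.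
\<close>

definition serre_step :: "nat \<Rightarrow> int \<Rightarrow> (nat \<Rightarrow> complex fps) \<Rightarrow> nat \<Rightarrow> complex fps"
  where "serre_step l m u i = serre_derivative (m - 2 * int i) (u i) +
    (case i of 0 \<Rightarrow> 0 | Suc p \<Rightarrow> fps_const (of_nat (l - p) / 12) * u p) -
    fps_const (of_nat (Suc i) / 12) * (E4 * u (Suc i))"

primrec serre_iterate :: "nat \<Rightarrow> int \<Rightarrow> (nat \<Rightarrow> complex fps) \<Rightarrow> nat \<Rightarrow> nat \<Rightarrow> complex fps"
  where
    "serre_iterate l w g 0 = g"
  | "serre_iterate l w g (Suc k) = serre_step l (w + 2 * int k) (serre_iterate l w g k)"

text \<open>The raising coefficient \<open>l - p\<close> vanishes at \<open>p = l\<close>, so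
  nothing leaks past index \<open>l\<close>.\<close>

lemma serre_iterate_beyond:
  assumes "\<And>i. i > l \<Longrightarrow> g i = 0" "i > l"
  shows "serre_iterate l w g k i = 0"
  using assms(2)
proof (induction k arbitrary: i)
  case (Suc k)
  then show ?case
    by (cases i) (auto simp: serre_step_def serre_derivative_def not_less_eq less_Suc_eq)
qed (use assms(1) in simp)

lemma serre_iterate_modular_forms:
  assumes "\<And>i. g i \<in> modular_forms (w - 2 * int i)"
  shows "serre_iterate l w g k i \<in> modular_forms (w + 2 * int k - 2 * int i)"
proof (induction k arbitrary: i)
  case (Suc k)
  let ?u = "serre_iterate l w g k"
  have weights: "w + 2 * int (Suc k) - 2 * int i = w + 2 * int k - 2 * int i + 2"
    "4 + (w + 2 * int k - 2 * int (Suc i)) = w + 2 * int k - 2 * int i + 2"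
    by simp_all
  have "serre_derivative (w + 2 * int k - 2 * int i) (?u i)
      \<in> modular_forms (w + 2 * int k - 2 * int i + 2)"
    by (rule serre_derivative_modular_forms) (rule Suc.IH)
  moreover have "(case i of 0 \<Rightarrow> 0 | Suc p \<Rightarrow> fps_const (of_nat (l - p) / 12) * ?u p)
      \<in> modular_forms (w + 2 * int k - 2 * int i + 2)"
  proof (cases i)
    case i: (Suc p)
    have "w + 2 * int k - 2 * int i + 2 = w + 2 * int k - 2 * int p"
      by (simp add: i)
    with modular_forms_scale[OF Suc.IH[of p]] show ?thesis
      by (simp only: i nat.case)
  qed simp
  moreover have "fps_const (of_nat (Suc i) / 12) * (E4 * ?u (Suc i))
      \<in> modular_forms (w + 2 * int k - 2 * int i + 2)"
    using modular_forms_scale[OF modular_forms_mult[OF modular_forms_E4 Suc.IH[of "Suc i"]]]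
    unfolding weights(2) .
  ultimately show ?case
    unfolding weights(1) serre_iterate.simps serre_step_def
    by (intro modular_forms_diff modular_forms_add)
qed (use assms in simp)

lemma fps_const_div_12:
  "fps_const (of_int n / 12 :: complex) = of_int n * fps_const (1 / 12)"
  "fps_const (of_nat k / 12 :: complex) = of_nat k * fps_const (1 / 12)"
proof -
  have "fps_const (of_int n / 12 :: complex) = fps_const (of_int n) * fps_const (1 / 12)"
    by simp
  then show "fps_const (of_int n / 12 :: complex) = of_int n * fps_const (1 / 12)"
    by (simp only: fps_of_int)
  have "fps_const (of_nat k / 12 :: complex) = fps_const (of_nat k) * fps_const (1 / 12)"
    by simp
  then show "fps_const (of_nat k / 12 :: complex) = of_nat k * fps_const (1 / 12)"
    by (simp only: fps_of_nat)
qed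

lemma twelve_times_twelfth: "12 * fps_const (1 / 12) = (1 :: complex fps)"
  by (simp add: numeral_fps_const)

text \<open>The sums with \<open>taylor E2\<close> are the coordinates after substituting
  \<open>Z = E2 * X + Y\<close>. In the basis \<open>X\<close>, \<open>Y\<close> the equation for
  \<open>E2\<close> cancels \<open>E4\<close>, leaving \<open>q d/dq\<close>, the nilpotent shift
  \<open>X \<mapsto> Y / 12\<close> and a scalar multiple of \<open>E2\<close>.\<close>

lemma taylor_serre_step:
  assumes "\<And>i. i > l \<Longrightarrow> u i = 0"
  shows "(\<Sum>i\<le>l. taylor E2 i j * serre_step l m u i) =
    fps_theta (\<Sum>i\<le>l. taylor E2 i j * u i) +
    (case j of 0 \<Rightarrow> 0 | Suc p \<Rightarrow>
      fps_const (of_int (int l - int p) / 12) * (\<Sum>i\<le>l. taylor E2 i p * u i)) +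
    - fps_const (of_int (m - int l) / 12) * E2 * (\<Sum>i\<le>l. taylor E2 i j * u i)"
proof -
  let ?h = "fps_const (1 / 12) :: complex fps"
  let ?t = "taylor E2"
  \<comment> \<open>The range can be extended to \<open>i = l\<close> because the factor
    \<open>l - i\<close> is 0 there.\<close>
  have raise: "(\<Sum>i\<le>l. ?t i j * (case i of 0 \<Rightarrow> 0 | Suc p \<Rightarrow> fps_const (of_nat (l - p) / 12) * u p)) =
      (\<Sum>i\<le>l. ?t (Suc i) j * (of_int (int l - int i) * ?h * u i))"
  proof -
    have "(\<Sum>i\<le>l. ?t i j * (case i of 0 \<Rightarrow> 0 | Suc p \<Rightarrow> fps_const (of_nat (l - p) / 12) * u p)) =
        (\<Sum>i<l. ?t (Suc i) j * (fps_const (of_nat (l - i) / 12) * u i))"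
      by (simp add: sum.atMost_shift)
    also have "\<dots> = (\<Sum>i<l. ?t (Suc i) j * (of_int (int l - int i) * ?h * u i))"
    proof (rule sum.cong[OF refl])
      fix i assume "i \<in> {..<l}"
      then have "(of_nat (l - i) :: complex) = of_int (int l - int i)"
        by (simp add: of_nat_diff)
      then show "?t (Suc i) j * (fps_const (of_nat (l - i) / 12) * u i) =
          ?t (Suc i) j * (of_int (int l - int i) * ?h * u i)"
        by (simp only: fps_const_div_12)
    qed
    also have "\<dots> = (\<Sum>i\<le>l. ?t (Suc i) j * (of_int (int l - int i) * ?h * u i))"
      by (simp add: lessThan_Suc_atMost[symmetric])
    finally show ?thesis .
  qed
  \<comment> \<open>After the index shift the extra term at \<open>Suc l\<close> is 0, as
    \<open>u\<close> vanishes beyond \<open>l\<close>.\<close>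
  have lower: "(\<Sum>i\<le>l. ?t i j * (fps_const (of_nat (Suc i) / 12) * (E4 * u (Suc i)))) =
      (\<Sum>i\<le>l. (case i of 0 \<Rightarrow> 0 | Suc p \<Rightarrow> of_nat i * ?t p j) * ?h * E4 * u i)"
  proof -
    have "(\<Sum>i\<le>Suc l. (case i of 0 \<Rightarrow> 0 | Suc p \<Rightarrow> of_nat i * ?t p j) * ?h * E4 * u i) =
        (\<Sum>i\<le>l. of_nat (Suc i) * ?t i j * ?h * E4 * u (Suc i))"
      by (subst sum.atMost_Suc_shift) simp
    moreover have "(\<Sum>i\<le>Suc l. (case i of 0 \<Rightarrow> 0 | Suc p \<Rightarrow> of_nat i * ?t p j) * ?h * E4 * u i) =
        (\<Sum>i\<le>l. (case i of 0 \<Rightarrow> 0 | Suc p \<Rightarrow> of_nat i * ?t p j) * ?h * E4 * u i)"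
      by (simp add: assms)
    ultimately show ?thesis
      by (simp only: fps_const_div_12) (simp only: ac_simps)
  qed
  have term_eq: "?t i j * serre_derivative (m - 2 * int i) (u i) +
      ?t (Suc i) j * (of_int (int l - int i) * ?h * u i) -
      (case i of 0 \<Rightarrow> 0 | Suc p \<Rightarrow> of_nat i * ?t p j) * ?h * E4 * u i =
      fps_theta (?t i j * u i) +
      (case j of 0 \<Rightarrow> 0 | Suc p \<Rightarrow> of_int (int l - int p) * ?h * (?t i p * u i)) +
      - (of_int (m - int l) * ?h) * E2 * (?t i j * u i)" for i
  proof -
    define c where "c = (case i of 0 \<Rightarrow> 0 | Suc p \<Rightarrow> of_nat i * ?t p j)"
    define h where "h = ?h"
    define d where "d = fps_theta (?t i j)"
    have h: "12 * h = 1"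
      unfolding h_def by (rule twelve_times_twelfth)
    have d12: "12 * d = (of_nat i - of_nat j) * E2 * ?t i j - E4 * c"
      unfolding c_def d_def by (rule fps_theta_taylor)
    have "d = 12 * h * d"
      by (simp add: h)
    also have "\<dots> = h * (12 * d)"
      by (simp only: ac_simps)
    finally have d: "d = h * ((of_nat i - of_nat j) * E2 * ?t i j - E4 * c)"
      by (simp only: d12)
    show ?thesis
    proof (cases j)
      case 0
      then show ?thesis
        unfolding c_def[symmetric] serre_derivative_def fps_const_div_12 h_def[symmetric]
          fps_theta_mult d_def[symmetric] d
        by (simp add: algebra_simps)
    next
      case (Suc p)
      \<comment> \<open>Absorption trades the surplus \<open>j * E2 * taylor E2 i j\<close> for the
        difference between the factors \<open>l - i\<close> and \<open>l - p\<close>.\<close>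
      have "of_nat (Suc p) * E2 * ?t i (Suc p) = (of_nat i - of_nat p) * ?t i p"
        by (rule taylor_absorption)
      then have "h * u i * (of_nat (Suc p) * E2 * ?t i j) = h * u i * ((of_nat i - of_nat p) * ?t i p)"
        using Suc by simp
      then show ?thesis
        unfolding c_def[symmetric] serre_derivative_def fps_const_div_12 h_def[symmetric]
          fps_theta_mult d_def[symmetric] d
        using Suc by (simp add: algebra_simps)
    qed
  qed
  have "(\<Sum>i\<le>l. ?t i j * serre_step l m u i) =
      (\<Sum>i\<le>l. ?t i j * serre_derivative (m - 2 * int i) (u i)) +
      (\<Sum>i\<le>l. ?t i j * (case i of 0 \<Rightarrow> 0 | Suc p \<Rightarrow> fps_const (of_nat (l - p) / 12) * u p)) -
      (\<Sum>i\<le>l. ?t i j * (fps_const (of_nat (Suc i) / 12) * (E4 * u (Suc i))))"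
    unfolding serre_step_def sum.distrib[symmetric] sum_subtractf[symmetric]
    by (simp only: distrib_left right_diff_distrib)
  also have "\<dots> = (\<Sum>i\<le>l. fps_theta (?t i j * u i) +
      (case j of 0 \<Rightarrow> 0 | Suc p \<Rightarrow> of_int (int l - int p) * ?h * (?t i p * u i)) +
      - (of_int (m - int l) * ?h) * E2 * (?t i j * u i))"
    unfolding raise lower sum.distrib[symmetric] sum_subtractf[symmetric]
    by (rule sum.cong[OF refl]) (rule term_eq)
  also have "\<dots> = fps_theta (\<Sum>i\<le>l. taylor E2 i j * u i) +
    (case j of 0 \<Rightarrow> 0 | Suc p \<Rightarrow>
      fps_const (of_int (int l - int p) / 12) * (\<Sum>i\<le>l. taylor E2 i p * u i)) +
    - fps_const (of_int (m - int l) / 12) * E2 * (\<Sum>i\<le>l. taylor E2 i j * u i)"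
    unfolding fps_theta_sum sum.distrib sum_distrib_left fps_const_div_12
    by (cases j) simp_all
  finally show ?thesis .
qed

section \<open>The determinant of the iterated derivatives\<close>

lemma fps_X_power_dvd_fps_theta:
  fixes f :: "complex fps"
  assumes "fps_X ^ n dvd f"
  shows "fps_X ^ n dvd fps_theta f"
proof -
  have X: "fps_theta (fps_X ^ n :: complex fps) = of_nat n * fps_X ^ n"
    by (rule fps_ext) (auto simp: fps_X_power_nth fps_mult_of_nat_nth)
  from assms obtain g where "f = fps_X ^ n * g" ..
  then have "fps_theta f = fps_X ^ n * (fps_theta g + of_nat n * g)"
    by (simp add: X algebra_simps)
  then show ?thesis
    by simp
qed

text \<open>The entry at \<open>(i, k)\<close> has weight \<open>w + 2 * k - 2 * i\<close>; along
  any permutation the shifts \<open>2 * k\<close> and \<open>2 * i\<close> cancel in total.\<close>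

lemma det_serre_iterate_modular_forms:
  assumes "\<And>i. g i \<in> modular_forms (w - 2 * int i)"
  shows "det (mat (Suc l) (Suc l) (\<lambda>(i, k). serre_iterate l w g k i))
    \<in> modular_forms ((int l + 1) * w)"
proof -
  let ?A = "mat (Suc l) (Suc l) (\<lambda>(i, k). serre_iterate l w g k i)"
  have "signof p * (\<Prod>i = 0..<Suc l. ?A $$ (i, p i)) \<in> modular_forms ((int l + 1) * w)"
    if p: "p permutes {0..<Suc l}" for p
  proof -
    have "(\<Prod>i = 0..<Suc l. ?A $$ (i, p i)) \<in>
        modular_forms (\<Sum>i = 0..<Suc l. w + 2 * int (p i) - 2 * int i)"
    proof (rule modular_forms_prod)
      fix i assume i: "i \<in> {0..<Suc l}"
      then have "p i \<in> {0..<Suc l}"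
        using p by (simp add: permutes_in_image)
      with i show "?A $$ (i, p i) \<in> modular_forms (w + 2 * int (p i) - 2 * int i)"
        using serre_iterate_modular_forms[OF assms] by simp
    qed
    also have "(\<Sum>i = 0..<Suc l. w + 2 * int (p i) - 2 * int i) = (int l + 1) * w"
    proof -
      have "(\<Sum>i = 0..<Suc l. int (p i)) = (\<Sum>i = 0..<Suc l. int i)"
        using sum.permute[OF p, of int] by (simp add: o_def)
      then show ?thesis
        by (simp only: sum_subtractf sum.distrib sum_distrib_left[symmetric]) simp
    qed
    finally have "(\<Prod>i = 0..<Suc l. ?A $$ (i, p i)) \<in> modular_forms ((int l + 1) * w)" .
    from modular_forms_scale[OF this, of "of_int (sign p)"] show ?thesis
      by (simp only: fps_of_int)
  qed
  moreover have "?A \<in> carrier_mat (Suc l) (Suc l)"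
    by simp
  ultimately show ?thesis
    unfolding det_def'[OF \<open>?A \<in> carrier_mat (Suc l) (Suc l)\<close>]
    by (intro modular_forms_sum) blast
qed

lemma subdegree_quasimodular_form:
  assumes g: "\<And>i. i \<le> l \<Longrightarrow> g i \<in> modular_forms (w - 2 * int i)"
    and f: "f = (\<Sum>i\<le>l. g i * E2 ^ i)" "f \<noteq> 0"
  shows "subdegree f < dim_modular ((int l + 1) * w)"
proof -
  define g' where "g' i = (if i \<le> l then g i else 0)" for i
  have g'_modular: "g' i \<in> modular_forms (w - 2 * int i)" for i
    using g by (simp add: g'_def)
  define u where "u = serre_iterate l w g'"
  define v where "v k j = (\<Sum>i\<le>l. taylor E2 i j * u k i)" for k j
  define s where "s k = - fps_const (of_int (w + 2 * int k - int l) / 12) * E2" for k :: nat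
  have u_beyond: "u k i = 0" if "i > l" for k i
    unfolding u_def using that by (intro serre_iterate_beyond) (simp_all add: g'_def)
  have step: "v (Suc k) j = fps_theta (v k j) + (case j of 0 \<Rightarrow> 0 | Suc p \<Rightarrow>
      fps_const (of_int (int l - int p) / 12) * v k p) + s k * v k j" for k j
    using taylor_serre_step[of l "u k" j "w + 2 * int k"] u_beyond
    unfolding v_def s_def by (simp add: u_def)
  interpret unipotent_iteration l "\<lambda>p. of_int (int l - int p) / 12" s v
    by unfold_locales (simp_all add: step)
  have v00: "v 0 0 = f"
    unfolding v_def f(1) by (rule sum.cong) (simp_all add: u_def g'_def taylor_0 mult.commute)
  define A where "A = mat (Suc l) (Suc l) (\<lambda>(i, k). u k i)"
  have A: "A \<in> carrier_mat (Suc l) (Suc l)"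
    by (simp add: A_def)
  have "det A \<noteq> 0"
  proof
    assume "det A = 0"
    then obtain c where c: "c \<in> carrier_vec (Suc l)" "c \<noteq> 0\<^sub>v (Suc l)" "A *\<^sub>v c = 0\<^sub>v (Suc l)"
      using det_0_iff_vec_prod_zero[OF A] by blast
    then obtain k where k: "k \<le> l" "c $ k \<noteq> 0"
      by (metis eq_vecI carrier_vecD index_zero_vec less_Suc_eq_le)
    have Ac: "(\<Sum>k\<le>l. c $ k * u k i) = 0" if "i \<le> l" for i
    proof -
      have "0 = (A *\<^sub>v c) $ i"
        using that by (simp add: c(3))
      also have "\<dots> = (\<Sum>k\<le>l. c $ k * u k i)"
        using that c(1)
        by (simp add: A_def scalar_prod_def mult.commute atLeast0LessThan lessThan_Suc_atMost
          del: sum.lessThan_Suc sum.op_ivl_Suc)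
      finally show ?thesis ..
    qed
    have "(\<Sum>k\<le>l. c $ k * v k j) = 0" for j
    proof -
      have "(\<Sum>k\<le>l. c $ k * v k j) = (\<Sum>i\<le>l. taylor E2 i j * (\<Sum>k\<le>l. c $ k * u k i))"
        unfolding v_def sum_distrib_left by (subst sum.swap) (simp only: ac_simps)
      then show ?thesis
        by (simp add: Ac)
    qed
    from linearly_independent[OF this k] v00 f(2) show False
      by simp
  qed
  \<comment> \<open>The component at index 0 receives nothing from the nilpotent shift, so each
    \<open>v k 0\<close> is a combination of derivatives of \<open>f\<close>.\<close>
  have dvd: "fps_X ^ subdegree f dvd v k 0" for k
  proof (induction k)
    case 0
    show ?case
      unfolding v00 by (metis dvd_triv_right subdegree_decompose)
  next
    case (Suc k)
    then show ?case
      unfolding v_0 by (intro dvd_add dvd_mult fps_X_power_dvd_fps_theta)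
  qed
  \<comment> \<open>Multiplying the row of powers \<open>E2 ^ i\<close> by \<open>A\<close> gives
    the row of the \<open>v k 0\<close>. Multiplying further by column 0 of the adjugate leaves
    \<open>E2 ^ 0 * det A\<close>.\<close>
  have "det A = (\<Sum>k<Suc l. v k 0 * adj_mat A $$ (k, 0))"
  proof -
    note adj = adj_mat[OF A]
    have "(\<Sum>k<Suc l. v k 0 * adj_mat A $$ (k, 0)) =
        (\<Sum>i\<le>l. E2 ^ i * (\<Sum>k<Suc l. u k i * adj_mat A $$ (k, 0)))"
      unfolding v_def sum_distrib_left sum_distrib_right taylor_0
      by (subst sum.swap) (simp only: ac_simps)
    also have "\<dots> = (\<Sum>i\<le>l. E2 ^ i * (A * adj_mat A) $$ (i, 0))"
    proof (rule sum.cong[OF refl])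
      fix i assume "i \<in> {..l}"
      then show "E2 ^ i * (\<Sum>k<Suc l. u k i * adj_mat A $$ (k, 0)) = E2 ^ i * (A * adj_mat A) $$ (i, 0)"
        using A adj(1)
        by (simp add: A_def scalar_prod_def atLeast0LessThan del: sum.lessThan_Suc sum.op_ivl_Suc)
    qed
    also have "\<dots> = (\<Sum>i\<le>l. if i = 0 then det A else 0)"
      unfolding adj(2) by (rule sum.cong) auto
    also have "\<dots> = det A"
      by simp
    finally show ?thesis ..
  qed
  then have "fps_X ^ subdegree f dvd det A"
    using dvd by (simp only:) (intro dvd_sum dvd_mult2)
  then obtain h where h: "det A = fps_X ^ subdegree f * h" ..
  with \<open>det A \<noteq> 0\<close> have "subdegree f \<le> subdegree (det A)"
    by (auto simp: subdegree_mult)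
  also have "\<dots> < dim_modular ((int l + 1) * w)"
    using det_serre_iterate_modular_forms[OF g'_modular] \<open>det A \<noteq> 0\<close>
    unfolding A_def u_def by (rule subdegree_less_dim_modular)
  finally show ?thesis .
qed

section \<open>The dimension formula\<close>

lemma dim_formula_double_add: "dim_formula (2 * (6 * a + y)) = a + dim_formula (2 * y)"
proof -
  have "2 * (6 * a + y) = 2 * y + a * 12"
    by simp
  then show ?thesis
    by (simp only: dim_formula_def mod_mult_self1 div_mult_self1) simp
qed

text \<open>With \<open>n = l + 1\<close> this compares the weights \<open>2 * y\<close> and
  \<open>2 * (y - 1)\<close>. Reduction of \<open>y\<close> and \<open>n\<close> modulo 6 makes the
  quotient contributions cancel and leaves 36 residue pairs.\<close>

lemma dim_formula_exchange:
  fixes n y :: int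
  shows "dim_formula (2 * (n * y)) + dim_formula (2 * (y - n)) =
    dim_formula (2 * (n * (y - 1))) + dim_formula (2 * y)"
proof -
  define a r b s where "a = y div 6" "r = y mod 6" "b = n div 6" "s = n mod 6"
  then have y: "y = 6 * a + r" and n: "n = 6 * b + s"
    by simp_all
  have shifts: "n * y = 6 * (6 * a * b + a * s + b * r) + r * s" "y - n = 6 * (a - b) + (r - s)"
    "n * (y - 1) = 6 * (6 * a * b + a * s + b * r - b) + (r * s - s)"
    unfolding y n by (simp_all add: algebra_simps)
  have "r \<in> {0, 1, 2, 3, 4, 5}" "s \<in> {0, 1, 2, 3, 4, 5}"
    unfolding \<open>r = y mod 6\<close> \<open>s = n mod 6\<close> by (simp, presburger)+
  then have "dim_formula (2 * (r * s)) + dim_formula (2 * (r - s)) =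
      dim_formula (2 * (r * s - s)) + dim_formula (2 * r)"
    by (elim insertE emptyE; simp add: dim_formula_def)
  moreover have "dim_formula (2 * y) = a + dim_formula (2 * r)"
    unfolding y by (rule dim_formula_double_add)
  ultimately show ?thesis
    unfolding shifts dim_formula_double_add by linarith
qed

text \<open>The difference behind \<open>kappa\<close>, formed with the untruncated formula so as to
  be constant over all even weights.\<close>

definition excess :: "nat \<Rightarrow> int \<Rightarrow> int"
  where "excess l w = dim_formula ((int l + 1) * w) - (\<Sum>i\<le>l. dim_formula (w - 2 * int i))"

text \<open>Raising the weight by 2 shifts the window of summation, gaining its top term and losing
  its bottom one; \<open>dim_formula_exchange\<close> balances this change.\<close>

lemma excess_constant:
  assumes "even w"
  shows "excess l w = excess l 0"
proof -
  have step: "excess l (2 * (x + 1)) = excess l (2 * x)" for x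
  proof -
    let ?d = "\<lambda>i. dim_formula (2 * (x + 1) - 2 * int i)"
    have "dim_formula (2 * (x + 1)) + (\<Sum>i\<le>l. ?d (Suc i)) = (\<Sum>i\<le>l. ?d i) + ?d (Suc l)"
      using sum.atMost_Suc_shift[of ?d l] by simp
    moreover have "?d (Suc i) = dim_formula (2 * x - 2 * int i)" for i
      by (simp add: algebra_simps)
    ultimately have "dim_formula (2 * (x + 1)) + (\<Sum>i\<le>l. dim_formula (2 * x - 2 * int i)) =
        (\<Sum>i\<le>l. ?d i) + dim_formula (2 * x - 2 * int l)"
      by simp
    then show ?thesis
      using dim_formula_exchange[of "int l + 1" "x + 1"]
      by (simp add: excess_def algebra_simps)
  qed
  have "excess l (2 * x) = excess l 0" for x
  proof (induction x rule: int_induct[where k = 0])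
    case (step1 i)
    then show ?case
      unfolding step by simp
  next
    case (step2 i)
    then show ?case
      using step[of "i - 1"] by simp
  qed simp
  with assms show ?thesis
    by (auto elim!: evenE)
qed

text \<open>Equality at nonnegative even weights; at negative weights the formula is at most 0,
  which is the dimension.\<close>

lemma dim_formula_le_dim_modular: "even w \<Longrightarrow> dim_formula w \<le> int (dim_modular w)"
  by (auto simp: dim_modular_eq dim_formula_def)

text \<open>The bound on \<open>w\<close> keeps all weights \<open>w - 2 * i\<close> nonnegative,
  where the formula and the dimension agree.\<close>

lemma dim_modular_sub_delta:
  assumes "even w" "w \<ge> 2 * int l + 12"
  shows "int (dim_modular ((int l + 1) * w)) - int (delta l w) = excess l 0"
proof -
  have "int (dim_modular (w - 2 * int i)) = dim_formula (w - 2 * int i)" if "i \<le> l" for i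
    using assms that by (simp add: dim_modular_eq)
  then have "int (delta l w) = (\<Sum>i\<le>l. dim_formula (w - 2 * int i))"
    by (simp add: delta_def)
  moreover have "(int l + 1) * w \<ge> 0"
    using assms(2) by simp
  then have "int (dim_modular ((int l + 1) * w)) = dim_formula ((int l + 1) * w)"
    using assms(1) by (simp add: dim_modular_eq)
  ultimately show ?thesis
    using excess_constant[OF assms(1), of l] by (simp add: excess_def)
qed

lemma kappa_eq_excess: "kappa l = excess l 0"
  unfolding kappa_def
proof (rule the_equality)
  fix k
  assume "\<forall>w. even w \<and> w \<ge> 2 * int l + 12 \<longrightarrow>
    int (dim_modular ((int l + 1) * w)) - int (delta l w) = k"
  then have "int (dim_modular ((int l + 1) * (2 * int l + 12))) - int (delta l (2 * int l + 12)) = k"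
    by simp
  then show "k = excess l 0"
    using dim_modular_sub_delta[of "2 * int l + 12" l] by simp
qed (simp add: dim_modular_sub_delta)

text \<open>At small weights, truncation can only enlarge the terms of \<open>delta\<close>, so the
  equality valid for large weights becomes an inequality.\<close>

lemma dim_modular_le_delta:
  assumes "even w" "w \<ge> 0"
  shows "int (dim_modular ((int l + 1) * w)) \<le> int (delta l w) + kappa l"
proof -
  have "(\<Sum>i\<le>l. dim_formula (w - 2 * int i)) \<le> int (delta l w)"
    unfolding delta_def of_nat_sum using assms(1) by (intro sum_mono dim_formula_le_dim_modular) simp
  moreover have "(int l + 1) * w \<ge> 0"
    using assms(2) by simp
  then have "int (dim_modular ((int l + 1) * w)) = dim_formula ((int l + 1) * w)"
    using assms(1) by (simp add: dim_modular_eq)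
  ultimately show ?thesis
    using excess_constant[OF assms(1), of l] by (simp add: kappa_eq_excess excess_def)
qed

section \<open>The bound on the order of vanishing\<close>

lemma subdegree_quasimodular_forms_depth_le:
  assumes "f \<in> quasimodular_forms_depth_le l w" "f \<noteq> 0"
  shows "subdegree f < dim_modular ((int l + 1) * w)"
proof -
  obtain l' where l': "l' \<le> l" "has_depth w f l'"
    using assms by (auto simp: quasimodular_forms_depth_le_def)
  then obtain g where g: "\<forall>i\<le>l'. g i \<in> modular_forms (w - 2 * int i)"
    "f = (\<Sum>i\<le>l'. g i * E2 ^ i)"
    by (auto simp: has_depth_def)
  \<comment> \<open>Padding with zeros turns an expansion of exact depth \<open>l'\<close> into one
    of length \<open>l\<close>, so that a single bound serves all depths.\<close>
  define g' where "g' i = (if i \<le> l' then g i else 0)" for i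
  show ?thesis
  proof (rule subdegree_quasimodular_form)
    have "(\<Sum>i\<le>l. g' i * E2 ^ i) = (\<Sum>i\<le>l'. g' i * E2 ^ i)"
      using l'(1) by (intro sum.mono_neutral_right) (auto simp: g'_def)
    then show "f = (\<Sum>i\<le>l. g' i * E2 ^ i)"
      by (simp add: g(2) g'_def)
    show "g' i \<in> modular_forms (w - 2 * int i)" for i
      using g(1) by (simp add: g'_def)
  qed (rule assms(2))
qed

theorem theorem2:
  fixes l :: nat and w :: int
  assumes "even w"
    and "quasimodular_forms_depth_le l w \<noteq> {0}"
  shows "(\<forall>w'. even w' \<and> w' \<ge> 2 * int l + 12 \<longrightarrow>
            int (dim_modular ((int l + 1) * w')) - int (delta l w') = kappa l) \<and>
         int (nu_max l w) \<le> int (delta l w) - 1 + kappa l"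
proof (intro conjI allI impI)
  fix w' :: int
  assume "even w' \<and> w' \<ge> 2 * int l + 12"
  then show "int (dim_modular ((int l + 1) * w')) - int (delta l w') = kappa l"
    by (simp add: dim_modular_sub_delta kappa_eq_excess)
next
  let ?Q = "quasimodular_forms_depth_le l w"
  let ?N = "dim_modular ((int l + 1) * w)"
  have "0 \<in> ?Q"
    by (simp add: quasimodular_forms_depth_le_def quasimodular_forms_def cfps.span_zero)
  then have nonempty: "?Q - {0} \<noteq> {}"
    using assms(2) by blast
  have bound: "subdegree f < ?N" if "f \<in> ?Q - {0}" for f
    using that by (intro subdegree_quasimodular_forms_depth_le) auto
  \<comment> \<open>The orders form a bounded, hence finite, set, so \<open>Max\<close> is
    attained.\<close>
  have "subdegree ` (?Q - {0}) \<subseteq> {..<?N}"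
  proof (rule image_subsetI)
    fix f assume "f \<in> ?Q - {0}"
    from bound[OF this] show "subdegree f \<in> {..<?N}"
      by (simp only: lessThan_iff)
  qed
  then have "finite (subdegree ` (?Q - {0}))"
    by (rule finite_subset) simp
  then have "nu_max l w \<in> subdegree ` (?Q - {0})"
    unfolding nu_max_def using nonempty by (intro Max_in) simp_all
  then have "nu_max l w < ?N"
    using bound by (elim imageE) simp
  \<comment> \<open>For negative \<open>w\<close> the dimension \<open>?N\<close> would be 0,
    leaving no room for any order.\<close>
  moreover have "w \<ge> 0"
  proof (rule ccontr)
    assume "\<not> w \<ge> 0"
    then have "(int l + 1) * w < 0"
      by (simp add: mult_pos_neg)
    then have "?N = 0"
      using dim_modular_eq[of "(int l + 1) * w"] by simp
    with \<open>nu_max l w < ?N\<close> show False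
      by simp
  qed
  ultimately show "int (nu_max l w) \<le> int (delta l w) - 1 + kappa l"
    using dim_modular_le_delta[OF assms(1), of l] by simp
qed

end
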